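(* Let $\phi\in L^{2}(\mathbb{R})\setminus\{0\}$, let $\epsilon_D,\epsilon_S\ge 0$, and let $f\in L^2(\mathbb{R})$, $f\neq0$. Suppose $f$ is $\epsilon_{D}$-concentrated on a measurable set $D\subseteq\mathbb{R}$ and its WOLCT $V_\phi^A f$ is $\epsilon_{S}$-concentrated on a measurable set $S\subseteq\mathbb{R}$. Then $$|D|\,|S|\ \geq\ 2\pi b\,(1-\epsilon_{D}-\epsilon_{S})^{2}.$$
   Context: Let $A=(a,b,c,d,u_{0},w_{0})$ with $a,b,c,d,u_0,w_0\in\mathbb{R}$, $ad-bc=1$ and $b\neq 0$. The offset linear canonical transform kernel is $$K_{A}(t,u)=\frac{1}{\sqrt{i2\pi b}}\,e^{i\frac{a}{2b}t^{2}-i\frac{1}{b}t(u-u_{0})-i\frac{1}{b}u(du_{0}-bw_{0})+i\frac{d}{2b}(u^{2}+u_{0}^{2})}.$$ For a window function $\phi\in L^2(\mathbb{R})\setminus\{0\}$, the windowed offset linear canonical transform (WOLCT) of $f\in L^2(\mathbb{R})$ is $$V^{A}_{\phi}f(u,w)=\int_{\mathbb{R}}f(t)\,\overline{\phi(t-w)}\,K_{A}(t,u)\,dt,\qquad (u,w)\in\mathbb{R}^2 .$$ For $\epsilon\ge0$, a function $f\in L^2(\mathbb{R})$ is $\epsilon$-concentrated on a measurable set $D\subseteq\mathbb{R}$ if $$\left(\int_{\mathbb{R}\setminus D}|f(t)|^{2}\,dt\right)^{\frac12}\leq\epsilon\,\|f\|_{L^2(\mathbb{R})}.$$ For $\epsilon\ge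 0$, the WOLCT $V_\phi^Af$ is $\epsilon$-concentrated on a measurable set $S\subseteq\mathbb{R}$ if $$\left(\int_{\mathbb{R}}\int_{\mathbb{R}\setminus S}|V_{\phi}^{A}f(u,w)|^{2}\,du\,dw\right)^{\frac12}\leq\epsilon\,\|V_{\phi}^{A}f\|_{2},\qquad \|V_{\phi}^{A}f\|_{2}=\left(\int_{\mathbb{R}}\int_{\mathbb{R}}|V_{\phi}^{A}f(u,w)|^{2}\,du\,dw\right)^{\frac12}.$$ $|D|$ and $|S|$ denote Lebesgue measures.
   Formalization: The formal statement adds the hypothesis ε_D + ε_S ≤ 1; without it the claim is false, e.g. D = S = ∅, ε_D = ε_S = 1 and b > 0 give 0 ≥ 2πb. *)

theory Defs
  imports "HOL-Analysis.Analysis"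
begin

text \<open>Square-integrable functions on the real line, as functions rather than classes modulo
  null sets; the zero class is \<open>AE t in lebesgue. f t = 0\<close>.\<close>

definition L2 :: "(real \<Rightarrow> complex) set" where
  "L2 = {f. f \<in> borel_measurable lebesgue \<and> integrable lebesgue (\<lambda>t. (cmod (f t))\<^sup>2)}"

text \<open>Parameters are tuples \<open>(a, b, c, d, u0, w0)\<close>. The kernel does not mention \<open>c\<close>, which enters
  only through the constraint \<open>a * d - b * c = 1\<close>. For \<open>b < 0\<close> the square root in the
  normalising factor is the principal branch.\<close>

type_synonym olct_params = "real \<times> real \<times> real \<times> real \<times> real \<times> real"

fun olct_kernel :: "olct_params \<Rightarrow> real \<Rightarrow> real \<Rightarrow> complex" where
  "olct_kernel (a, b, c, d, u0, w0) t u =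
     1 / csqrt (\<i> * of_real (2 * pi * b)) *
     exp (\<i> * of_real (a / (2 * b) * t\<^sup>2 - 1 / b * t * (u - u0)
                      - 1 / b * u * (d * u0 - b * w0) + d / (2 * b) * (u\<^sup>2 + u0\<^sup>2)))"

text \<open>For \<open>f\<close> and \<open>\<phi>\<close> in \<^const>\<open>L2\<close> the integrand is Lebesgue integrable for every \<open>u\<close> and \<open>w\<close>.\<close>

definition wolct ::
  "olct_params \<Rightarrow> (real \<Rightarrow> complex) \<Rightarrow> (real \<Rightarrow> complex) \<Rightarrow> real \<Rightarrow> real \<Rightarrow> complex" where
  "wolct A \<phi> f u w = (LINT t|lebesgue. f t * cnj (\<phi> (t - w)) * olct_kernel A t u)"

text \<open>The integrals of squared moduli are taken in \<^typ>\<open>ennreal\<close>, so that a divergent integral has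
  the value \<open>\<infinity>\<close> and not the default value \<open>0\<close> of the Bochner integral.\<close>

definition ennsqrt :: "ennreal \<Rightarrow> ennreal" where
  "ennsqrt x = (if x = \<infinity> then \<infinity> else ennreal (sqrt (enn2real x)))"

definition concentrated :: "real \<Rightarrow> (real \<Rightarrow> complex) \<Rightarrow> real set \<Rightarrow> bool" where
  "concentrated \<epsilon> f D \<longleftrightarrow>
     ennsqrt (\<integral>\<^sup>+t\<in>-D. ennreal ((cmod (f t))\<^sup>2) \<partial>lebesgue)
       \<le> ennreal \<epsilon> * ennsqrt (\<integral>\<^sup>+t. ennreal ((cmod (f t))\<^sup>2) \<partial>lebesgue)"

text \<open>Only the first variable of \<open>V\<close> is restricted to the complement of \<open>S\<close>.\<close>

definition tf_concentrated :: "real \<Rightarrow> (real \<Rightarrow> real \<Rightarrow> complex) \<Rightarrow> real set \<Rightarrow> bool" where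
  "tf_concentrated \<epsilon> V S \<longleftrightarrow>
     ennsqrt (\<integral>\<^sup>+w. (\<integral>\<^sup>+u\<in>-S. ennreal ((cmod (V u w))\<^sup>2) \<partial>lebesgue) \<partial>lebesgue)
       \<le> ennreal \<epsilon> *
         ennsqrt (\<integral>\<^sup>+w. (\<integral>\<^sup>+u. ennreal ((cmod (V u w))\<^sup>2) \<partial>lebesgue) \<partial>lebesgue)"

end

theory Submission
  imports Defs "HOL-Probability.Characteristic_Functions"
begin

text \<open>For fixed \<open>w\<close> the function \<open>u \<mapsto> V f (u, w)\<close> is, up to a unimodular factor, the constant
  \<open>(2 \<pi> \<bar>b\<bar>)\<^bsup>-1/2\<^esup>\<close> and the rescaling \<open>u / b\<close>, the Fourier transform of \<open>f(t) \<phi>(t - w)\<^sup>*\<close> times a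
  chirp (\<open>wolct_eq_fourier\<close>). Plancherel's formula in \<open>u\<close> and Tonelli's theorem in \<open>w\<close> therefore
  give Moyal's identity \<open>\<parallel>V f\<parallel> = \<parallel>f\<parallel> \<parallel>\<phi>\<parallel>\<close> (\<open>wolct_moyal\<close>). Call this number \<open>N\<close>.

  The inequality is then obtained as by Donoho and Stark. Split \<open>f\<close> into its restrictions to \<open>D\<close>
  and to the complement of \<open>D\<close>, and look at the energy of the transforms over the strip \<open>u \<in> S\<close>.
  The transform of the first part satisfies
  \<open>\<bar>V f\<^sub>D (u, w)\<bar>\<^sup>2 \<le> \<bar>D\<bar> / (2 \<pi> \<bar>b\<bar>) \<integral> \<bar>f(t)\<bar>\<^sup>2 \<bar>\<phi>(t - w)\<bar>\<^sup>2 dt\<close> by the Cauchy-Schwarz inequality, so that its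
  norm over the strip is at most \<open>sqrt (\<bar>D\<bar> \<bar>S\<bar> / (2 \<pi> \<bar>b\<bar>)) N\<close> (\<open>wolct_local_bound\<close>). The second part
  contributes at most \<open>\<epsilon>D N\<close>, by Moyal's identity and the concentration of \<open>f\<close>. The energy
  of \<open>V f\<close> itself over the strip is at least \<open>(1 - \<epsilon>S\<^sup>2) N\<^sup>2 \<ge> ((1 - \<epsilon>S) N)\<^sup>2\<close>. Minkowski's inequality
  yields \<open>1 - \<epsilon>S \<le> sqrt (\<bar>D\<bar> \<bar>S\<bar> / (2 \<pi> \<bar>b\<bar>)) + \<epsilon>D\<close>, and since \<open>\<epsilon>D + \<epsilon>S \<le> 1\<close> this may be squared.
  The bound holds with \<open>\<bar>b\<bar>\<close>, which is at least \<open>b\<close>.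

  Plancherel's formula is proved by Gaussian regularisation. Weighted by \<open>exp (- u\<^sup>2 / (2 n\<^sup>2))\<close>, the integral
  of \<open>\<bar>\<F> g\<bar>\<^sup>2\<close> can be evaluated with Fubini's theorem, because the characteristic function of the normal
  distribution is known: it is \<open>2 \<pi>\<close> times the mean of the autocorrelation of \<open>g\<close> at \<open>y / n\<close>, with \<open>y\<close> normally
  distributed. As \<open>n\<close> grows the weighted integrals increase to the full one, and the
  autocorrelation tends to its value \<open>\<parallel>g\<parallel>\<^sup>2\<close> at zero, because translations act continuously on \<open>L\<^sup>2\<close>.

  All of this is done for Borel functions and sets. Changing \<open>f\<close> and \<open>\<phi>\<close> on null sets does not
  change \<open>V f\<close> at any point, and Borel representatives exist, so the Lebesgue measurable
  case follows.\<close>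

section \<open>Continuity of translation in \<open>L\<^sup>1\<close> and \<open>L\<^sup>2\<close>\<close>

lemma integrable_lborel_shift:
  fixes g :: "real \<Rightarrow> 'a :: {banach, second_countable_topology}"
  assumes "integrable lborel g"
  shows "integrable lborel (\<lambda>t. g (t - x))"
  using lborel_integrable_real_affine[OF assms, of 1 "-x"] by simp

lemma integral_lborel_shift:
  fixes g :: "real \<Rightarrow> 'a :: {banach, second_countable_topology}"
  shows "(\<integral>t. g (t - x) \<partial>lborel) = (\<integral>t. g t \<partial>lborel)"
  using lborel_integral_real_affine[of 1 g "-x"] by simp

text \<open>Translation preserves the \<open>L\<^sup>1\<close> norm, so the property of being translated continuously is closed
  under \<open>L\<^sup>1\<close> limits. This carries it from open sets to Borel sets and from simple functions to integrable ones.\<close>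

lemma L1_translation_approx:
  fixes g :: "real \<Rightarrow> 'a :: {banach, second_countable_topology}"
  assumes g: "integrable lborel g"
    and approx: "\<And>e. e > 0 \<Longrightarrow> \<exists>h. integrable lborel h \<and> (\<integral>t. norm (g t - h t) \<partial>lborel) < e \<and>
        (\<lambda>n. \<integral>t. norm (h (t - X n) - h t) \<partial>lborel) \<longlonglongrightarrow> 0"
  shows "(\<lambda>n. \<integral>t. norm (g (t - X n) - g t) \<partial>lborel) \<longlonglongrightarrow> 0"
proof (rule LIMSEQ_I)
  fix r :: real assume "r > 0"
  then obtain h where h: "integrable lborel h" and close: "(\<integral>t. norm (g t - h t) \<partial>lborel) < r / 3"
    and lim: "(\<lambda>n. \<integral>t. norm (h (t - X n) - h t) \<partial>lborel) \<longlonglongrightarrow> 0"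
    using approx[of "r / 3"] by auto
  obtain N where N: "\<And>n. n \<ge> N \<Longrightarrow> norm (\<integral>t. norm (h (t - X n) - h t) \<partial>lborel) < r / 3"
    using LIMSEQ_D[OF lim, of "r / 3"] \<open>r > 0\<close> by auto
  have bound: "(\<integral>t. norm (g (t - x) - g t) \<partial>lborel) \<le>
      2 * (\<integral>t. norm (g t - h t) \<partial>lborel) + (\<integral>t. norm (h (t - x) - h t) \<partial>lborel)" for x
  proof -
    note [simp] = g h integrable_lborel_shift[OF g] integrable_lborel_shift[OF h]
    have "(\<integral>t. norm (g (t - x) - g t) \<partial>lborel) \<le>
        (\<integral>t. norm (g (t - x) - h (t - x)) + norm (g t - h t) + norm (h (t - x) - h t) \<partial>lborel)"
    proof (rule integral_mono)
      fix t
      have eq: "g (t - x) - g t = (g (t - x) - h (t - x)) - (g t - h t) + (h (t - x) - h t)"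
        by simp
      show "norm (g (t - x) - g t) \<le>
          norm (g (t - x) - h (t - x)) + norm (g t - h t) + norm (h (t - x) - h t)"
        by (subst eq) (rule order_trans[OF norm_triangle_ineq add_right_mono[OF norm_triangle_ineq4]])
    qed auto
    also have "\<dots> = (\<integral>t. norm (g (t - x) - h (t - x)) \<partial>lborel) + (\<integral>t. norm (g t - h t) \<partial>lborel)
        + (\<integral>t. norm (h (t - x) - h t) \<partial>lborel)"
      by simp
    also have "(\<integral>t. norm (g (t - x) - h (t - x)) \<partial>lborel) = (\<integral>t. norm (g t - h t) \<partial>lborel)"
      by (rule integral_lborel_shift[of "\<lambda>t. norm (g t - h t)"])
    finally show ?thesis by simp
  qed
  have "(\<integral>t. norm (g (t - X n) - g t) \<partial>lborel) < r" if "n \<ge> N" for n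
    using N[OF that] close bound[of "X n"] by simp
  then have "norm ((\<integral>t. norm (g (t - X n) - g t) \<partial>lborel) - 0) < r" if "n \<ge> N" for n
    using that by simp
  then show "\<exists>no. \<forall>n\<ge>no. norm ((\<integral>t. norm (g (t - X n) - g t) \<partial>lborel) - 0) < r"
    by blast
qed

text \<open>For open \<open>U\<close> and \<open>t \<in> U\<close> also \<open>t - X n \<in> U\<close> eventually, so the indicator of \<open>U\<close> minus that of
  \<open>U \<inter> (U + X n)\<close> tends to zero pointwise, dominated by the former. Half of the symmetric difference of \<open>U\<close> and
  its translate is of this form, and the other half has the same measure.\<close>

lemma L1_translation_open:
  fixes c :: "'a :: {banach, second_countable_topology}" and U :: "real set"
  assumes U: "open U" "emeasure lborel U < \<infinity>" and X: "X \<longlonglongrightarrow> 0"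
  shows "(\<lambda>n. \<integral>t. norm (indicat_real U (t - X n) *\<^sub>R c - indicat_real U t *\<^sub>R c) \<partial>lborel) \<longlonglongrightarrow> 0"
proof -
  have [measurable]: "U \<in> sets borel" using U by auto
  have int: "integrable lborel (indicat_real U)"
    using U by simp
  note shift = integrable_lborel_shift[OF int]
  have prod: "integrable lborel (\<lambda>t. indicat_real U t * indicat_real U (t - x))" for x
    by (rule Bochner_Integration.integrable_bound[OF int]) (auto simp: indicator_def)
  have eq: "(\<integral>t. norm (indicat_real U (t - x) *\<^sub>R c - indicat_real U t *\<^sub>R c) \<partial>lborel) =
      2 * norm c * (\<integral>t. indicat_real U t - indicat_real U t * indicat_real U (t - x) \<partial>lborel)" for x
  proof -
    have "(\<integral>t. norm (indicat_real U (t - x) *\<^sub>R c - indicat_real U t *\<^sub>R c) \<partial>lborel) =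
        (\<integral>t. norm c * (indicat_real U (t - x) + indicat_real U t
          - 2 * (indicat_real U t * indicat_real U (t - x))) \<partial>lborel)"
      by (rule Bochner_Integration.integral_cong) (auto simp: indicator_def)
    also have "\<dots> = norm c * ((\<integral>t. indicat_real U (t - x) \<partial>lborel) + (\<integral>t. indicat_real U t \<partial>lborel)
          - 2 * (\<integral>t. indicat_real U t * indicat_real U (t - x) \<partial>lborel))"
      using int shift prod
      by (subst integral_mult_right_zero, subst Bochner_Integration.integral_diff, simp, simp)
         (subst Bochner_Integration.integral_add, auto)
    also have "(\<integral>t. indicat_real U (t - x) \<partial>lborel) = (\<integral>t. indicat_real U t \<partial>lborel)"
      by (rule integral_lborel_shift)
    finally show ?thesis
      using int prod by (simp add: algebra_simps)
  qed
  have "(\<lambda>n. \<integral>t. indicat_real U t - indicat_real U t * indicat_real U (t - X n) \<partial>lborel)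
      \<longlonglongrightarrow> (\<integral>t. 0 \<partial>(lborel :: real measure))"
  proof (rule integral_dominated_convergence)
    show "integrable lborel (indicat_real U)" by (rule int)
    show "AE t in lborel. (\<lambda>n. indicat_real U t - indicat_real U t * indicat_real U (t - X n)) \<longlonglongrightarrow> 0"
    proof (rule AE_I2)
      fix t
      show "(\<lambda>n. indicat_real U t - indicat_real U t * indicat_real U (t - X n)) \<longlonglongrightarrow> 0"
      proof (cases "t \<in> U")
        case True
        have "(\<lambda>n. t - X n) \<longlonglongrightarrow> t"
          using tendsto_diff[OF tendsto_const X, of t] by simp
        then have "\<forall>\<^sub>F n in sequentially. t - X n \<in> U"
          using U(1) True by (rule topological_tendstoD)
        then have "\<forall>\<^sub>F n in sequentially. indicat_real U t - indicat_real U t * indicat_real U (t - X n) = 0"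
          by eventually_elim (use True in auto)
        then show ?thesis by (rule tendsto_eventually)
      qed simp
    qed
  qed (auto simp: indicator_def)
  then have "(\<lambda>n. 2 * norm c * (\<integral>t. indicat_real U t - indicat_real U t * indicat_real U (t - X n) \<partial>lborel))
      \<longlonglongrightarrow> 2 * norm c * 0"
    by (intro tendsto_intros) simp
  then show ?thesis unfolding eq by simp
qed

text \<open>Outer regularity replaces a Borel set by an open one, for which
  \<open>L1_translation_open\<close> applies.\<close>

lemma L1_translation_continuous:
  fixes g :: "real \<Rightarrow> 'a :: {banach, second_countable_topology}"
  assumes g: "integrable lborel g" and X: "X \<longlonglongrightarrow> 0"
  shows "(\<lambda>n. \<integral>t. norm (g (t - X n) - g t) \<partial>lborel) \<longlonglongrightarrow> 0"
  using g
proof (induction rule: integrable_induct)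
  case (base A c)
  then have [measurable]: "A \<in> sets borel" by simp
  have intA: "integrable lborel (\<lambda>t. indicat_real A t *\<^sub>R c)"
    using base by (intro integrable_scaleR_left) simp
  show ?case
  proof (rule L1_translation_approx[OF intA])
    fix e :: real assume "e > 0"
    \<comment> \<open>The summand \<open>1\<close> keeps the denominator positive when \<open>c = 0\<close>.\<close>
    define d where "d = e / (norm c + 1)"
    have "d > 0" unfolding d_def using \<open>e > 0\<close> by (intro divide_pos_pos) (auto intro: add_nonneg_pos)
    obtain U where U: "open U" "A \<subseteq> U" "emeasure lborel (U - A) < ennreal d"
      using outer_regular_lborel[of A d] \<open>d > 0\<close> by auto
    have [measurable]: "U \<in> sets borel" using U by auto
    have finD: "emeasure lborel (U - A) < \<infinity>"
      using U(3) by (rule less_trans) simp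
    have "emeasure lborel U = emeasure lborel A + emeasure lborel (U - A)"
      using U(2) by (subst plus_emeasure) (auto simp: Un_absorb1)
    also have "\<dots> < \<infinity>"
      using base finD by simp
    finally have fin: "emeasure lborel U < \<infinity>" .
    have "(\<integral>t. norm (indicat_real A t *\<^sub>R c - indicat_real U t *\<^sub>R c) \<partial>lborel)
        = (\<integral>t. norm c * indicat_real (U - A) t \<partial>lborel)"
      using U(2) by (intro Bochner_Integration.integral_cong) (auto simp: indicator_def)
    also have "\<dots> = norm c * measure lborel (U - A)"
      using finD by simp
    also have "\<dots> \<le> norm c * d"
      using U(3) finD \<open>d > 0\<close>
      by (intro mult_left_mono) (auto simp: measure_def enn2real_leI less_imp_le)
    also have "\<dots> < (norm c + 1) * d"
      using \<open>d > 0\<close> by simp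
    also have "\<dots> = e"
      unfolding d_def using norm_ge_zero[of c] by (simp add: add_nonneg_eq_0_iff)
    finally have "(\<integral>t. norm (indicat_real A t *\<^sub>R c - indicat_real U t *\<^sub>R c) \<partial>lborel) < e" .
    moreover have "integrable lborel (\<lambda>t. indicat_real U t *\<^sub>R c)"
      using fin by (intro integrable_scaleR_left) simp
    ultimately show "\<exists>h. integrable lborel h \<and>
        (\<integral>t. norm (indicat_real A t *\<^sub>R c - h t) \<partial>lborel) < e \<and>
        (\<lambda>n. \<integral>t. norm (h (t - X n) - h t) \<partial>lborel) \<longlonglongrightarrow> 0"
      using L1_translation_open[OF U(1) fin X, of c] by (intro exI[of _ "\<lambda>t. indicat_real U t *\<^sub>R c"]) auto
  qed
next
  case (add f g)
  note [simp] = add.hyps integrable_lborel_shift[OF add.hyps(1)] integrable_lborel_shift[OF add.hyps(2)]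
  have lim: "(\<lambda>n. (\<integral>t. norm (f (t - X n) - f t) \<partial>lborel) + (\<integral>t. norm (g (t - X n) - g t) \<partial>lborel)) \<longlonglongrightarrow> 0"
    using tendsto_add[OF add.IH] by simp
  show ?case
  proof (rule tendsto_sandwich[OF _ _ tendsto_const lim])
    show "\<forall>\<^sub>F n in sequentially. 0 \<le> (\<integral>t. norm (f (t - X n) + g (t - X n) - (f t + g t)) \<partial>lborel)"
      by simp
    have "(\<integral>t. norm (f (t - X n) + g (t - X n) - (f t + g t)) \<partial>lborel) \<le>
        (\<integral>t. norm (f (t - X n) - f t) + norm (g (t - X n) - g t) \<partial>lborel)" for n
      by (intro integral_mono) (auto intro: norm_diff_triangle_ineq)
    then show "\<forall>\<^sub>F n in sequentially. (\<integral>t. norm (f (t - X n) + g (t - X n) - (f t + g t)) \<partial>lborel) \<le>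
        (\<integral>t. norm (f (t - X n) - f t) \<partial>lborel) + (\<integral>t. norm (g (t - X n) - g t) \<partial>lborel)"
      by simp
  qed
next
  case (lim f s)
  show ?case
  proof (rule L1_translation_approx[OF lim.hyps(4)])
    fix e :: real assume "e > 0"
    have "(\<lambda>i. \<integral>t. norm (f t - s i t) \<partial>lborel) \<longlonglongrightarrow> (\<integral>t. 0 \<partial>(lborel :: real measure))"
    proof (rule integral_dominated_convergence)
      show "integrable lborel (\<lambda>t. 3 * norm (f t))" using lim.hyps(4) by simp
      show "AE t in lborel. (\<lambda>i. norm (f t - s i t)) \<longlonglongrightarrow> 0"
      proof (rule AE_I2)
        fix t :: real
        show "(\<lambda>i. norm (f t - s i t)) \<longlonglongrightarrow> 0"
          using tendsto_norm[OF tendsto_diff[OF tendsto_const lim.hyps(2)[of t], of "f t"]] by simp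
      qed
      show "AE t in lborel. norm (norm (f t - s i t)) \<le> 3 * norm (f t)" for i
        proof (rule AE_I2)
        fix t :: real
        show "norm (norm (f t - s i t)) \<le> 3 * norm (f t)"
          using lim.hyps(3)[of t i] norm_triangle_ineq4[of "f t" "s i t"] by simp
      qed
    qed (use lim in auto)
    then have "\<forall>\<^sub>F i in sequentially. (\<integral>t. norm (f t - s i t) \<partial>lborel) < e"
      using \<open>e > 0\<close> by (intro order_tendstoD) auto
    then obtain i where "(\<integral>t. norm (f t - s i t) \<partial>lborel) < e"
      by (auto simp: eventually_sequentially)
    then show "\<exists>h. integrable lborel h \<and> (\<integral>t. norm (f t - h t) \<partial>lborel) < e \<and>
        (\<lambda>n. \<integral>t. norm (h (t - X n) - h t) \<partial>lborel) \<longlonglongrightarrow> 0"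
      using lim.hyps(1) lim.IH by blast
  qed
qed

text \<open>Cutting \<open>g\<close> off at height \<open>k\<close> leaves a bounded part \<open>h k\<close>, for which the squared \<open>L\<^sup>2\<close> distance to a translate
  is at most \<open>2 k\<close> times the \<open>L\<^sup>1\<close> distance, and a remainder \<open>r k\<close> that is small in \<open>L\<^sup>2\<close>.\<close>

lemma L2_translation_continuous:
  fixes g :: "real \<Rightarrow> 'a :: {banach, second_countable_topology}"
  assumes g: "integrable lborel g" and g2: "integrable lborel (\<lambda>t. (norm (g t))\<^sup>2)"
    and X: "X \<longlonglongrightarrow> 0"
  shows "(\<lambda>n. \<integral>t. (norm (g (t - X n) - g t))\<^sup>2 \<partial>lborel) \<longlonglongrightarrow> 0"
proof (rule LIMSEQ_I)
  fix e :: real assume "e > 0"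
  have [measurable]: "g \<in> borel_measurable borel" using g by auto
  define h where "h k t = (if norm (g t) \<le> real k then g t else 0)" for k t
  define r where "r k t = (if norm (g t) \<le> real k then 0 else g t)" for k t
  have [measurable]: "h k \<in> borel_measurable borel" "r k \<in> borel_measurable borel" for k
    unfolding h_def[abs_def] r_def[abs_def] by measurable
  have h: "integrable lborel (h k)" for k
    by (rule Bochner_Integration.integrable_bound[OF g]) (auto simp: h_def)
  have r: "integrable lborel (\<lambda>t. (norm (r k t))\<^sup>2)" for k
    by (rule Bochner_Integration.integrable_bound[OF g2]) (auto simp: r_def)
  have hb: "norm (h k t) \<le> real k" for k t by (simp add: h_def)
  have "(\<lambda>k. \<integral>t. (norm (r k t))\<^sup>2 \<partial>lborel) \<longlonglongrightarrow> (\<integral>t. 0 \<partial>(lborel :: real measure))"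
  proof (rule integral_dominated_convergence[OF _ _ g2])
    show "AE t in lborel. (\<lambda>k. (norm (r k t))\<^sup>2) \<longlonglongrightarrow> 0"
    proof (rule AE_I2)
      fix t :: real
      obtain K where K: "norm (g t) \<le> real K" using real_arch_simple by blast
      have "\<forall>\<^sub>F k in sequentially. (norm (r k t))\<^sup>2 = 0"
        using eventually_ge_at_top[of K]
        by eventually_elim (use K in \<open>auto simp: r_def\<close>)
      then show "(\<lambda>k. (norm (r k t))\<^sup>2) \<longlonglongrightarrow> 0" by (rule tendsto_eventually)
    qed
  qed (auto simp: r_def)
  then have "\<forall>\<^sub>F k in sequentially. (\<integral>t. (norm (r k t))\<^sup>2 \<partial>lborel) < e / 12"
    using \<open>e > 0\<close> by (intro order_tendstoD) auto
  then obtain k where k: "(\<integral>t. (norm (r k t))\<^sup>2 \<partial>lborel) < e / 12"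
    by (auto simp: eventually_sequentially)
  \<comment> \<open>The factor \<open>6 k\<close> comes from \<open>(p + q + s)\<^sup>2 \<le> 3 (p\<^sup>2 + q\<^sup>2 + s\<^sup>2)\<close> and \<open>s\<^sup>2 \<le> 2 k s\<close>; see \<open>bound\<close> below.\<close>
  have "(\<lambda>n. 6 * real k * (\<integral>t. norm (h k (t - X n) - h k t) \<partial>lborel)) \<longlonglongrightarrow> 6 * real k * 0"
    by (intro tendsto_intros L1_translation_continuous h X)
  then have "\<forall>\<^sub>F n in sequentially. 6 * real k * (\<integral>t. norm (h k (t - X n) - h k t) \<partial>lborel) < e / 2"
    using \<open>e > 0\<close> by (intro order_tendstoD) auto
  then obtain M where M: "\<And>n. n \<ge> M \<Longrightarrow> 6 * real k * (\<integral>t. norm (h k (t - X n) - h k t) \<partial>lborel) < e / 2"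
    by (auto simp: eventually_sequentially)
  have bound: "(\<integral>t. (norm (g (t - x) - g t))\<^sup>2 \<partial>lborel) \<le>
      6 * (\<integral>t. (norm (r k t))\<^sup>2 \<partial>lborel) + 6 * real k * (\<integral>t. norm (h k (t - x) - h k t) \<partial>lborel)" for x
  proof -
    have r': "integrable lborel (\<lambda>t. (norm (r k (t - x)))\<^sup>2)"
      by (rule integrable_lborel_shift[OF r])
    have h': "integrable lborel (\<lambda>t. norm (h k (t - x) - h k t))"
      using h integrable_lborel_shift[OF h] by simp
    have "(\<integral>t. (norm (g (t - x) - g t))\<^sup>2 \<partial>lborel) \<le>
        (\<integral>t. 3 * (norm (r k (t - x)))\<^sup>2 + 3 * (norm (r k t))\<^sup>2
          + 6 * real k * norm (h k (t - x) - h k t) \<partial>lborel)"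
    proof (rule integral_mono')
      fix t
      define p q s where "p = norm (r k (t - x))" and "q = norm (r k t)"
        and "s = norm (h k (t - x) - h k t)"
      have eq: "g (t - x) - g t = (r k (t - x) - r k t) + (h k (t - x) - h k t)"
        by (auto simp: r_def h_def)
      have "norm (g (t - x) - g t) \<le> p + q + s"
        unfolding eq p_def q_def s_def
        by (rule order_trans[OF norm_triangle_ineq add_right_mono[OF norm_triangle_ineq4]])
      then have "(norm (g (t - x) - g t))\<^sup>2 \<le> (p + q + s)\<^sup>2"
        by (intro power_mono) auto
      also have "\<dots> \<le> 3 * p\<^sup>2 + 3 * q\<^sup>2 + 3 * s\<^sup>2"
        using zero_le_power2[of "p - q"] zero_le_power2[of "p - s"] zero_le_power2[of "q - s"]
        by (simp add: power2_eq_square algebra_simps)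
      also have "s\<^sup>2 \<le> 2 * real k * s"
      proof -
        have "s \<le> 2 * real k"
          unfolding s_def using norm_triangle_ineq4[of "h k (t - x)" "h k t"] hb[of k t] hb[of k "t - x"]
          by linarith
        then show ?thesis
          unfolding power2_eq_square by (intro mult_right_mono) (simp_all add: s_def)
      qed
      finally show "(norm (g (t - x) - g t))\<^sup>2 \<le> 3 * (norm (r k (t - x)))\<^sup>2 + 3 * (norm (r k t))\<^sup>2
          + 6 * real k * norm (h k (t - x) - h k t)"
        by (simp add: p_def q_def s_def)
    qed (use r r' h' in auto)
    also have "\<dots> = 3 * (\<integral>t. (norm (r k (t - x)))\<^sup>2 \<partial>lborel) + 3 * (\<integral>t. (norm (r k t))\<^sup>2 \<partial>lborel)
        + 6 * real k * (\<integral>t. norm (h k (t - x) - h k t) \<partial>lborel)"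
      using r r' h' by simp
    also have "(\<integral>t. (norm (r k (t - x)))\<^sup>2 \<partial>lborel) = (\<integral>t. (norm (r k t))\<^sup>2 \<partial>lborel)"
      by (rule integral_lborel_shift[of "\<lambda>t. (norm (r k t))\<^sup>2"])
    finally show ?thesis by simp
  qed
  have "(\<integral>t. (norm (g (t - X n) - g t))\<^sup>2 \<partial>lborel) < e" if "n \<ge> M" for n
    using bound[of "X n"] M[OF that] k by linarith
  then show "\<exists>no. \<forall>n\<ge>no. norm ((\<integral>t. (norm (g (t - X n) - g t))\<^sup>2 \<partial>lborel) - 0) < e"
    by (intro exI[of _ M]) simp
qed

section \<open>Plancherel's formula on \<open>L\<^sup>1 \<inter> L\<^sup>2\<close>\<close>

lemma cnj_borel_measurable [measurable]: "cnj \<in> borel_measurable borel"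
  by (intro borel_measurable_continuous_onI continuous_intros)

lemma L2_mult_cnj:
  fixes g h :: "real \<Rightarrow> complex"
  assumes [measurable]: "g \<in> borel_measurable borel" "h \<in> borel_measurable borel"
    and g2: "integrable lborel (\<lambda>t. (cmod (g t))\<^sup>2)" and h2: "integrable lborel (\<lambda>t. (cmod (h t))\<^sup>2)"
  shows integrable_L2_mult_cnj: "integrable lborel (\<lambda>t. g t * cnj (h t))"
    and integral_norm_L2_mult_cnj_le: "(\<integral>t. norm (g t * cnj (h t)) \<partial>lborel) \<le>
      (\<integral>t. (cmod (g t))\<^sup>2 \<partial>lborel) + (\<integral>t. (cmod (h t))\<^sup>2 \<partial>lborel)"
proof -
  have amgm: "norm (g t * cnj (h t)) \<le> (cmod (g t))\<^sup>2 + (cmod (h t))\<^sup>2" for t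
  proof -
    have "2 * (cmod (g t) * cmod (h t)) \<le> (cmod (g t))\<^sup>2 + (cmod (h t))\<^sup>2"
      using zero_le_power2[of "cmod (g t) - cmod (h t)"] by (simp add: power2_diff mult.assoc)
    moreover have "0 \<le> cmod (g t) * cmod (h t)" by simp
    ultimately show ?thesis unfolding norm_mult complex_mod_cnj by linarith
  qed
  have sum: "integrable lborel (\<lambda>t. (cmod (g t))\<^sup>2 + (cmod (h t))\<^sup>2)"
    using g2 h2 by simp
  show int: "integrable lborel (\<lambda>t. g t * cnj (h t))"
    by (rule Bochner_Integration.integrable_bound[OF sum]) (auto intro: amgm)
  have "(\<integral>t. norm (g t * cnj (h t)) \<partial>lborel) \<le> (\<integral>t. (cmod (g t))\<^sup>2 + (cmod (h t))\<^sup>2 \<partial>lborel)"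
    using sum int amgm by (intro integral_mono) auto
  then show "(\<integral>t. norm (g t * cnj (h t)) \<partial>lborel) \<le>
      (\<integral>t. (cmod (g t))\<^sup>2 \<partial>lborel) + (\<integral>t. (cmod (h t))\<^sup>2 \<partial>lborel)"
    using g2 h2 by simp
qed

definition fourier :: "(real \<Rightarrow> complex) \<Rightarrow> real \<Rightarrow> complex" where
  "fourier g x = (\<integral>t. g t * iexp (- (t * x)) \<partial>lborel)"

lemma fourier_measurable [measurable]:
  assumes [measurable]: "g \<in> borel_measurable borel"
  shows "fourier g \<in> borel_measurable borel"
  unfolding fourier_def[abs_def] by measurable

lemma cmod_fourier_le:
  assumes "integrable lborel g"
  shows "cmod (fourier g x) \<le> (\<integral>t. cmod (g t) \<partial>lborel)"
proof -
  have "cmod (fourier g x) \<le> (\<integral>t. cmod (g t * iexp (- (t * x))) \<partial>lborel)"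
    unfolding fourier_def by (rule integral_norm_bound)
  then show ?thesis by (simp add: norm_mult)
qed

lemma integrable_lborel_pair_mult:
  fixes g h :: "real \<Rightarrow> complex"
  assumes g: "integrable lborel g" and h: "integrable lborel h"
  shows "integrable (lborel \<Otimes>\<^sub>M lborel) (\<lambda>(t, s). g t * h s)"
proof -
  have [measurable]: "g \<in> borel_measurable borel" "h \<in> borel_measurable borel"
    using g h by auto
  show ?thesis
    by (rule lborel_pair.Fubini_integrable) (use g h in \<open>auto simp: norm_mult\<close>)
qed

text \<open>Writing \<open>\<bar>\<F> g\<bar>\<^sup>2\<close> as a double integral turns it into a superposition of exponentials in \<open>x\<close>, which can be
  averaged over \<open>x\<close> term by term.\<close>

lemma norm_fourier_square:
  assumes g: "integrable lborel g"
  shows "complex_of_real ((cmod (fourier g x))\<^sup>2) =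
    (\<integral>p. g (fst p) * cnj (g (snd p)) * iexp (x * (snd p - fst p)) \<partial>(lborel \<Otimes>\<^sub>M lborel))"
proof -
  have [measurable]: "g \<in> borel_measurable borel" using g by auto
  define k where "k t = g t * iexp (- (t * x))" for t
  have [measurable]: "k \<in> borel_measurable borel" unfolding k_def[abs_def] by measurable
  have k: "integrable lborel k"
    by (rule Bochner_Integration.integrable_bound[OF g]) (auto simp: k_def norm_mult)
  have kc: "integrable lborel (\<lambda>t. cnj (k t))" using k by simp
  have "complex_of_real ((cmod (fourier g x))\<^sup>2) = fourier g x * cnj (fourier g x)"
    by (rule complex_norm_square)
  also have "\<dots> = (\<integral>t. k t \<partial>lborel) * (\<integral>s. cnj (k s) \<partial>lborel)"
    by (simp only: fourier_def k_def[symmetric] Bochner_Integration.integral_cnj)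
  also have "\<dots> = (\<integral>t. (\<integral>s. k t * cnj (k s) \<partial>lborel) \<partial>lborel)"
    by simp
  also have "\<dots> = (\<integral>p. (\<lambda>(t, s). k t * cnj (k s)) p \<partial>(lborel \<Otimes>\<^sub>M lborel))"
    using lborel_pair.integral_fst'[OF integrable_lborel_pair_mult[OF k kc]] by simp
  also have "\<dots> = (\<integral>p. g (fst p) * cnj (g (snd p)) * iexp (x * (snd p - fst p)) \<partial>(lborel \<Otimes>\<^sub>M lborel))"
    by (rule Bochner_Integration.integral_cong)
       (auto simp: k_def exp_cnj mult_exp_exp[symmetric] algebra_simps exp_diff exp_minus field_simps)
  finally show ?thesis .
qed

abbreviation "gauss \<equiv> std_normal_distribution"

lemma prob_space_gauss: "prob_space gauss"
  by (rule prob_space_normal_density) simp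

text \<open>The mean over \<open>v\<close> of the exponential \<open>iexp (c v (s - t))\<close> is the Gaussian \<open>exp (- (c (s - t))\<^sup>2 / 2)\<close>. In the
  variable \<open>y = c (t - s)\<close> this is again a multiple of the normal density, and integration over \<open>t\<close> leaves the
  autocorrelation of \<open>g\<close> at \<open>y / c\<close>.\<close>

lemma gaussian_mean_fourier:
  assumes g: "integrable lborel g" and g2: "integrable lborel (\<lambda>t. (cmod (g t))\<^sup>2)" and c: "c > 0"
  shows "c * (\<integral>v. (cmod (fourier g (c * v)))\<^sup>2 \<partial>gauss) =
    sqrt (2 * pi) * (\<integral>y. Re (\<integral>t. g t * cnj (g (t - y / c)) \<partial>lborel) \<partial>gauss)"
proof -
  have gm [measurable]: "g \<in> borel_measurable borel" using g by auto
  interpret N: prob_space gauss by (rule prob_space_gauss)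
  interpret P: sigma_finite_measure "lborel \<Otimes>\<^sub>M lborel :: (real \<times> real) measure"
    unfolding lborel_prod by (rule sigma_finite_lborel)
  interpret NP: pair_sigma_finite gauss "lborel \<Otimes>\<^sub>M lborel :: (real \<times> real) measure" ..
  interpret NL: pair_sigma_finite gauss "lborel :: real measure" ..
  define G where "G p = g (fst p) * cnj (g (snd p))" for p
  have [measurable]: "G \<in> borel_measurable (lborel \<Otimes>\<^sub>M lborel)"
    unfolding G_def[abs_def] by measurable
  have G: "integrable (lborel \<Otimes>\<^sub>M lborel) G"
    using integrable_lborel_pair_mult[OF g, of "\<lambda>t. cnj (g t)"] g by (simp add: G_def[abs_def] case_prod_beta')
  define H where "H v p = G p * iexp (c * v * (snd p - fst p))" for v p
  have Hm [measurable]: "case_prod H \<in> borel_measurable (gauss \<Otimes>\<^sub>M (lborel \<Otimes>\<^sub>M lborel))"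
    unfolding H_def[abs_def] by measurable
  have H: "integrable (gauss \<Otimes>\<^sub>M (lborel \<Otimes>\<^sub>M lborel)) (case_prod H)"
  proof (rule NP.Fubini_integrable[OF Hm])
    show "integrable gauss (\<lambda>x. \<integral>y. norm (case_prod H (x, y)) \<partial>(lborel \<Otimes>\<^sub>M lborel))"
      by (simp add: H_def norm_mult)
    have "integrable (lborel \<Otimes>\<^sub>M lborel) (H x)" for x
      unfolding H_def[abs_def]
      by (rule Bochner_Integration.integrable_bound[OF G]) (auto simp: norm_mult)
    then show "AE x in gauss. integrable (lborel \<Otimes>\<^sub>M lborel) (\<lambda>y. case_prod H (x, y))"
      by simp
  qed
  have char: "(\<integral>v. H v p \<partial>gauss) = G p * exp (- (c * (snd p - fst p))\<^sup>2 / 2)" for p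
  proof -
    have "(\<integral>v. H v p \<partial>gauss) = (\<integral>v. G p * iexp ((c * (snd p - fst p)) * v) \<partial>gauss)"
      by (simp add: H_def mult_ac)
    also have "\<dots> = G p * char gauss (c * (snd p - fst p))"
      unfolding char_def by (rule integral_mult_right_zero)
    finally show ?thesis by (simp add: char_std_normal_distribution)
  qed
  define E where "E p = G p * exp (- (c * (snd p - fst p))\<^sup>2 / 2)" for p
  have [measurable]: "E \<in> borel_measurable (lborel \<Otimes>\<^sub>M lborel)"
    unfolding E_def[abs_def] by measurable
  have E: "integrable (lborel \<Otimes>\<^sub>M lborel) E"
    by (rule Bochner_Integration.integrable_bound[OF G]) (auto simp: E_def norm_mult mult_left_le)
  note shift = integrable_lborel_shift[OF g2]
  have int': "integrable lborel (\<lambda>t. g t * cnj (g (t - x)))" for x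
    by (rule integrable_L2_mult_cnj[OF _ _ g2 shift]) auto
  have bound: "(\<integral>t. norm (g t * cnj (g (t - x))) \<partial>lborel) \<le> 2 * (\<integral>t. (cmod (g t))\<^sup>2 \<partial>lborel)" for x
    using integral_norm_L2_mult_cnj_le[OF _ _ g2 shift[of x]]
      integral_lborel_shift[of "\<lambda>t. (cmod (g t))\<^sup>2"] by simp
  have FI: "integrable (gauss \<Otimes>\<^sub>M lborel) (\<lambda>(y, t). g t * cnj (g (t - y / c)))"
  proof (rule NL.Fubini_integrable)
    show "integrable gauss (\<lambda>x. \<integral>y. norm (case (x, y) of (y, t) \<Rightarrow> g t * cnj (g (t - y / c))) \<partial>lborel)"
      by (rule N.integrable_const_bound[where B = "2 * (\<integral>t. (cmod (g t))\<^sup>2 \<partial>lborel)"])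
         (use bound in auto)
  qed (use int' in auto)
  have "complex_of_real (\<integral>v. (cmod (fourier g (c * v)))\<^sup>2 \<partial>gauss) =
      (\<integral>v. complex_of_real ((cmod (fourier g (c * v)))\<^sup>2) \<partial>gauss)"
    by (rule integral_complex_of_real[symmetric])
  also have "\<dots> = (\<integral>v. (\<integral>p. H v p \<partial>(lborel \<Otimes>\<^sub>M lborel)) \<partial>gauss)"
    unfolding norm_fourier_square[OF g] H_def G_def ..
  also have "\<dots> = (\<integral>p. E p \<partial>(lborel \<Otimes>\<^sub>M lborel))"
    unfolding NP.Fubini_integral[OF H, symmetric] char E_def ..
  also have "\<dots> = (\<integral>t. (\<integral>s. E (t, s) \<partial>lborel) \<partial>lborel)"
    by (rule lborel_pair.integral_fst'[OF E, symmetric])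
  also have "\<dots> = (\<integral>t. (\<integral>y. complex_of_real (sqrt (2 * pi) / c) * (g t * cnj (g (t - y / c))) \<partial>gauss) \<partial>lborel)"
  proof (rule Bochner_Integration.integral_cong[OF refl])
    fix t :: real
    \<comment> \<open>Substitution \<open>s = t - y / c\<close>; the normal density has to be supplemented by \<open>sqrt (2 \<pi>)\<close>.\<close>
    have "(\<integral>s. E (t, s) \<partial>lborel) = \<bar>-1/c\<bar> *\<^sub>R (\<integral>y. E (t, t + (-1/c) * y) \<partial>lborel)"
      using c by (intro lborel_integral_real_affine) simp
    also have "\<dots> = (\<integral>y. (1/c) *\<^sub>R E (t, t + (-1/c) * y) \<partial>lborel)"
      using c by simp
    also have "\<dots> = (\<integral>y. std_normal_density y *\<^sub>R
        (complex_of_real (sqrt (2 * pi) / c) * (g t * cnj (g (t - y / c)))) \<partial>lborel)"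
      using c by (intro Bochner_Integration.integral_cong)
        (auto simp: E_def G_def std_normal_density_def scaleR_conv_of_real exp_of_real power2_eq_square)
    also have "\<dots> = (\<integral>y. complex_of_real (sqrt (2 * pi) / c) * (g t * cnj (g (t - y / c))) \<partial>gauss)"
      by (rule integral_density[symmetric]) auto
    finally show "(\<integral>s. E (t, s) \<partial>lborel) =
        (\<integral>y. complex_of_real (sqrt (2 * pi) / c) * (g t * cnj (g (t - y / c))) \<partial>gauss)" .
  qed
  also have "\<dots> = complex_of_real (sqrt (2 * pi) / c) * (\<integral>t. (\<integral>y. g t * cnj (g (t - y / c)) \<partial>gauss) \<partial>lborel)"
    by simp
  also have "(\<integral>t. (\<integral>y. g t * cnj (g (t - y / c)) \<partial>gauss) \<partial>lborel) =
      (\<integral>y. (\<integral>t. g t * cnj (g (t - y / c)) \<partial>lborel) \<partial>gauss)"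
    by (rule NL.Fubini_integral[OF FI])
  finally have "(\<integral>v. (cmod (fourier g (c * v)))\<^sup>2 \<partial>gauss) =
    Re (complex_of_real (sqrt (2 * pi) / c) * (\<integral>y. (\<integral>t. g t * cnj (g (t - y / c)) \<partial>lborel) \<partial>gauss))"
    by (metis Re_complex_of_real)
  also have "\<dots> = sqrt (2 * pi) / c * Re (\<integral>y. (\<integral>t. g t * cnj (g (t - y / c)) \<partial>lborel) \<partial>gauss)"
    by simp
  also have "Re (\<integral>y. (\<integral>t. g t * cnj (g (t - y / c)) \<partial>lborel) \<partial>gauss) =
      (\<integral>y. Re (\<integral>t. g t * cnj (g (t - y / c)) \<partial>lborel) \<partial>gauss)"
    using NL.integrable_fst'[OF FI] by (intro integral_Re[symmetric]) simp
  finally show ?thesis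
    using c by simp
qed

text \<open>Polarisation expresses the autocorrelation by the \<open>L\<^sup>2\<close> distance between \<open>g\<close> and its translate; the
  parallelogram law bounds that distance.\<close>

lemma Re_autocorrelation:
  fixes g :: "real \<Rightarrow> complex"
  assumes [measurable]: "g \<in> borel_measurable borel" and g2: "integrable lborel (\<lambda>t. (cmod (g t))\<^sup>2)"
  shows "Re (\<integral>t. g t * cnj (g (t - x)) \<partial>lborel) =
      (\<integral>t. (cmod (g t))\<^sup>2 \<partial>lborel) - (\<integral>t. (cmod (g (t - x) - g t))\<^sup>2 \<partial>lborel) / 2"
    and "\<bar>Re (\<integral>t. g t * cnj (g (t - x)) \<partial>lborel)\<bar> \<le> (\<integral>t. (cmod (g t))\<^sup>2 \<partial>lborel)"
proof -
  note shift = integrable_lborel_shift[OF g2]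
  have corr: "integrable lborel (\<lambda>t. g t * cnj (g (t - x)))"
    by (rule integrable_L2_mult_cnj[OF _ _ g2 shift]) auto
  have re: "integrable lborel (\<lambda>t. Re (g t * cnj (g (t - x))))"
    by (rule integrable_Re[OF corr])
  have sq: "(\<integral>t. (cmod (g (t - x)))\<^sup>2 \<partial>lborel) = (\<integral>t. (cmod (g t))\<^sup>2 \<partial>lborel)"
    by (rule integral_lborel_shift[of "\<lambda>t. (cmod (g t))\<^sup>2"])
  have polar: "(cmod (w - z))\<^sup>2 = (cmod w)\<^sup>2 + (cmod z)\<^sup>2 - 2 * Re (z * cnj w)" for w z
    unfolding cmod_power2 by (simp add: power2_eq_square algebra_simps)
  have par: "(cmod (w - z))\<^sup>2 \<le> 2 * (cmod w)\<^sup>2 + 2 * (cmod z)\<^sup>2" for w z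
    using zero_le_power2[of "cmod (w + z)"] unfolding cmod_power2
    by (simp add: power2_eq_square algebra_simps)
  have diff: "integrable lborel (\<lambda>t. (cmod (g (t - x) - g t))\<^sup>2)"
    unfolding polar
    by (intro Bochner_Integration.integrable_diff Bochner_Integration.integrable_add
        integrable_mult_right g2 shift re)
  have "(\<integral>t. (cmod (g (t - x) - g t))\<^sup>2 \<partial>lborel) =
      2 * (\<integral>t. (cmod (g t))\<^sup>2 \<partial>lborel) - 2 * (\<integral>t. Re (g t * cnj (g (t - x))) \<partial>lborel)"
    unfolding polar using g2 shift[of x] re sq by (simp del: times_complex.sel cnj.sel)
  then show eq: "Re (\<integral>t. g t * cnj (g (t - x)) \<partial>lborel) =
      (\<integral>t. (cmod (g t))\<^sup>2 \<partial>lborel) - (\<integral>t. (cmod (g (t - x) - g t))\<^sup>2 \<partial>lborel) / 2"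
    using integral_Re[OF corr] by (simp add: field_simps)
  have "(\<integral>t. (cmod (g (t - x) - g t))\<^sup>2 \<partial>lborel) \<le> (\<integral>t. 2 * (cmod (g (t - x)))\<^sup>2 + 2 * (cmod (g t))\<^sup>2 \<partial>lborel)"
    using g2 shift[of x] diff par by (intro integral_mono) auto
  also have "\<dots> = 4 * (\<integral>t. (cmod (g t))\<^sup>2 \<partial>lborel)"
    using g2 shift[of x] sq by simp
  finally have "(\<integral>t. (cmod (g (t - x) - g t))\<^sup>2 \<partial>lborel) \<le> 4 * (\<integral>t. (cmod (g t))\<^sup>2 \<partial>lborel)" .
  moreover have "0 \<le> (\<integral>t. (cmod (g (t - x) - g t))\<^sup>2 \<partial>lborel)"
    by simp
  ultimately show "\<bar>Re (\<integral>t. g t * cnj (g (t - x)) \<partial>lborel)\<bar> \<le> (\<integral>t. (cmod (g t))\<^sup>2 \<partial>lborel)"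
    unfolding eq by linarith
qed

lemma autocorrelation_tendsto:
  fixes g :: "real \<Rightarrow> complex"
  assumes g: "integrable lborel g" and g2: "integrable lborel (\<lambda>t. (cmod (g t))\<^sup>2)"
    and X: "X \<longlonglongrightarrow> 0"
  shows "(\<lambda>n. Re (\<integral>t. g t * cnj (g (t - X n)) \<partial>lborel)) \<longlonglongrightarrow> (\<integral>t. (cmod (g t))\<^sup>2 \<partial>lborel)"
proof -
  have gm: "g \<in> borel_measurable borel" using g by auto
  have "(\<lambda>n. (\<integral>t. (cmod (g t))\<^sup>2 \<partial>lborel) - (\<integral>t. (cmod (g (t - X n) - g t))\<^sup>2 \<partial>lborel) / 2)
      \<longlonglongrightarrow> (\<integral>t. (cmod (g t))\<^sup>2 \<partial>lborel) - 0 / 2"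
    by (intro tendsto_intros L2_translation_continuous g g2 X) simp
  then show ?thesis
    unfolding Re_autocorrelation(1)[OF gm g2] by simp
qed

text \<open>The substitution \<open>u = c v\<close> connects the Gaussian mean of \<open>gaussian_mean_fourier\<close> with a weight that
  increases to \<open>1\<close> as \<open>c\<close> grows.\<close>

lemma nn_integral_fourier_gaussian:
  assumes g: "integrable lborel g" and c: "c > 0"
  shows "(\<integral>\<^sup>+u. ennreal ((cmod (fourier g u))\<^sup>2 * exp (- (u / c)\<^sup>2 / 2)) \<partial>lborel) =
    ennreal (sqrt (2 * pi) * (c * (\<integral>v. (cmod (fourier g (c * v)))\<^sup>2 \<partial>gauss)))"
proof -
  have gm [measurable]: "g \<in> borel_measurable borel" using g by auto
  interpret N: prob_space gauss by (rule prob_space_gauss)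
  have "(\<integral>\<^sup>+u. ennreal ((cmod (fourier g u))\<^sup>2 * exp (- (u / c)\<^sup>2 / 2)) \<partial>lborel) =
      ennreal c * (\<integral>\<^sup>+v. ennreal ((cmod (fourier g (c * v)))\<^sup>2 * exp (- v\<^sup>2 / 2)) \<partial>lborel)"
    using c by (subst nn_integral_real_affine[where c = c and t = 0]) auto
  also have "(\<integral>\<^sup>+v. ennreal ((cmod (fourier g (c * v)))\<^sup>2 * exp (- v\<^sup>2 / 2)) \<partial>lborel) =
      (\<integral>\<^sup>+v. ennreal (std_normal_density v) * (ennreal (sqrt (2 * pi)) * ennreal ((cmod (fourier g (c * v)))\<^sup>2)) \<partial>lborel)"
    by (intro nn_integral_cong) (auto simp: std_normal_density_def ennreal_mult[symmetric] field_simps)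
  also have "\<dots> = (\<integral>\<^sup>+v. ennreal (sqrt (2 * pi)) * ennreal ((cmod (fourier g (c * v)))\<^sup>2) \<partial>gauss)"
    by (subst nn_integral_density) auto
  also have "\<dots> = ennreal (sqrt (2 * pi)) * (\<integral>\<^sup>+v. ennreal ((cmod (fourier g (c * v)))\<^sup>2) \<partial>gauss)"
    by (rule nn_integral_cmult) simp
  also have "(\<integral>\<^sup>+v. ennreal ((cmod (fourier g (c * v)))\<^sup>2) \<partial>gauss) =
      ennreal (\<integral>v. (cmod (fourier g (c * v)))\<^sup>2 \<partial>gauss)"
  proof (rule nn_integral_eq_integral)
    show "integrable gauss (\<lambda>v. (cmod (fourier g (c * v)))\<^sup>2)"
      by (rule N.integrable_const_bound[where B = "(\<integral>t. cmod (g t) \<partial>lborel)\<^sup>2"])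
         (auto intro!: power_mono cmod_fourier_le g)
  qed simp
  finally show ?thesis
    using c by (simp add: ennreal_mult[symmetric] mult_ac)
qed

text \<open>Two limits of the same sequence \<open>I\<close>: monotone convergence on the Fourier side, dominated convergence and
  continuity of the autocorrelation on the other.\<close>

theorem plancherel:
  assumes g: "integrable lborel g" and g2: "integrable lborel (\<lambda>t. (cmod (g t))\<^sup>2)"
  shows "(\<integral>\<^sup>+u. ennreal ((cmod (fourier g u))\<^sup>2) \<partial>lborel) =
    ennreal (2 * pi) * (\<integral>\<^sup>+t. ennreal ((cmod (g t))\<^sup>2) \<partial>lborel)"
proof -
  have gm [measurable]: "g \<in> borel_measurable borel" using g by auto
  interpret N: prob_space gauss by (rule prob_space_gauss)
  define I where "I n = (\<integral>\<^sup>+u. ennreal ((cmod (fourier g u))\<^sup>2 * exp (- (u / real (Suc n))\<^sup>2 / 2)) \<partial>lborel)" for n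
  define B where "B x = Re (\<integral>t. g t * cnj (g (t - x)) \<partial>lborel)" for x
  have [measurable]: "B \<in> borel_measurable borel" unfolding B_def[abs_def] by measurable
  have "I n = ennreal (sqrt (2 * pi) * (sqrt (2 * pi) * (\<integral>y. B (y / real (Suc n)) \<partial>gauss)))" for n
    unfolding I_def B_def
    by (subst nn_integral_fourier_gaussian[OF g], simp, subst gaussian_mean_fourier[OF g g2], simp_all)
  then have I: "I n = ennreal (2 * pi * (\<integral>y. B (y / real (Suc n)) \<partial>gauss))" for n
    by (simp add: mult.assoc[symmetric])
  have "(\<lambda>n. \<integral>y. B (y / real (Suc n)) \<partial>gauss) \<longlonglongrightarrow> (\<integral>y. (\<integral>t. (cmod (g t))\<^sup>2 \<partial>lborel) \<partial>gauss)"
  proof (rule integral_dominated_convergence)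
    show "AE y in gauss. (\<lambda>n. B (y / real (Suc n))) \<longlonglongrightarrow> (\<integral>t. (cmod (g t))\<^sup>2 \<partial>lborel)"
    proof (rule AE_I2)
      fix y :: real
      have "(\<lambda>n. y / real (Suc n)) \<longlonglongrightarrow> 0"
        using tendsto_mult_right_zero[OF lim_inverse_n'[THEN LIMSEQ_Suc], of y] by (simp add: divide_inverse)
      then show "(\<lambda>n. B (y / real (Suc n))) \<longlonglongrightarrow> (\<integral>t. (cmod (g t))\<^sup>2 \<partial>lborel)"
        unfolding B_def by (rule autocorrelation_tendsto[OF g g2])
    qed
    show "AE y in gauss. norm (B (y / real (Suc n))) \<le> (\<integral>t. (cmod (g t))\<^sup>2 \<partial>lborel)" for n
      using Re_autocorrelation(2)[OF gm g2] by (simp add: B_def)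
  qed auto
  then have "(\<lambda>n. 2 * pi * (\<integral>y. B (y / real (Suc n)) \<partial>gauss)) \<longlonglongrightarrow> 2 * pi * (\<integral>t. (cmod (g t))\<^sup>2 \<partial>lborel)"
    using N.prob_space by (intro tendsto_intros) simp
  then have lim1: "I \<longlonglongrightarrow> ennreal (2 * pi * (\<integral>t. (cmod (g t))\<^sup>2 \<partial>lborel))"
    unfolding I[abs_def] by (rule tendsto_ennrealI)
  have lim2: "I \<longlonglongrightarrow> (\<integral>\<^sup>+u. ennreal ((cmod (fourier g u))\<^sup>2) \<partial>lborel)"
    unfolding I_def[abs_def]
  proof (rule nn_integral_LIMSEQ)
    show "incseq (\<lambda>n u. ennreal ((cmod (fourier g u))\<^sup>2 * exp (- (u / real (Suc n))\<^sup>2 / 2)))"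
    proof (intro incseq_SucI le_funI ennreal_leI mult_left_mono)
      fix n :: nat and u :: real
      have "\<bar>u / real (Suc (Suc n))\<bar> \<le> \<bar>u / real (Suc n)\<bar>"
        by (simp add: divide_left_mono)
      then have "(u / real (Suc (Suc n)))\<^sup>2 \<le> (u / real (Suc n))\<^sup>2"
        by (rule abs_le_square_iff[THEN iffD1])
      then show "exp (- (u / real (Suc n))\<^sup>2 / 2) \<le> exp (- (u / real (Suc (Suc n)))\<^sup>2 / 2)"
        by simp
    qed simp
    show "(\<lambda>n. ennreal ((cmod (fourier g u))\<^sup>2 * exp (- (u / real (Suc n))\<^sup>2 / 2))) \<longlonglongrightarrow>
        ennreal ((cmod (fourier g u))\<^sup>2)" for u
    proof (rule tendsto_ennrealI)
      have "(\<lambda>n. u / real (Suc n)) \<longlonglongrightarrow> 0"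
        using tendsto_mult_right_zero[OF lim_inverse_n'[THEN LIMSEQ_Suc], of u] by (simp add: divide_inverse)
      then have "(\<lambda>n. (cmod (fourier g u))\<^sup>2 * exp (- (u / real (Suc n))\<^sup>2 / 2)) \<longlonglongrightarrow>
          (cmod (fourier g u))\<^sup>2 * exp (- 0\<^sup>2 / 2)"
        by (intro tendsto_intros) simp_all
      then show "(\<lambda>n. (cmod (fourier g u))\<^sup>2 * exp (- (u / real (Suc n))\<^sup>2 / 2)) \<longlonglongrightarrow>
          (cmod (fourier g u))\<^sup>2"
        by simp
    qed
  qed auto
  have "(\<integral>\<^sup>+u. ennreal ((cmod (fourier g u))\<^sup>2) \<partial>lborel) = ennreal (2 * pi * (\<integral>t. (cmod (g t))\<^sup>2 \<partial>lborel))"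
    by (rule LIMSEQ_unique[OF lim2 lim1])
  also have "\<dots> = ennreal (2 * pi) * (\<integral>\<^sup>+t. ennreal ((cmod (g t))\<^sup>2) \<partial>lborel)"
    using g2 by (simp add: ennreal_mult nn_integral_eq_integral)
  finally show ?thesis .
qed

section \<open>Isometry and local bound for the windowed transform\<close>

text \<open>The function whose Fourier transform at \<open>u / b\<close> gives the windowed transform at \<open>(u, w)\<close>. The exponential
  collects the phases of the kernel that depend on \<open>t\<close> alone.\<close>

definition chirped_product :: "real \<Rightarrow> real \<Rightarrow> real \<Rightarrow> (real \<Rightarrow> complex) \<Rightarrow> (real \<Rightarrow> complex) \<Rightarrow> real \<Rightarrow> real \<Rightarrow> complex" where
  "chirped_product a b u0 \<phi> f w t = f t * cnj (\<phi> (t - w)) * iexp (a / (2 * b) * t\<^sup>2 + t * u0 / b)"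

lemma chirped_product_measurable [measurable]:
  assumes [measurable]: "f \<in> borel_measurable borel" "\<phi> \<in> borel_measurable borel"
  shows "case_prod (chirped_product a b u0 \<phi> f) \<in> borel_measurable (borel \<Otimes>\<^sub>M borel)"
    and "chirped_product a b u0 \<phi> f w \<in> borel_measurable borel"
  unfolding chirped_product_def[abs_def] by measurable

lemma cmod_chirped_product: "cmod (chirped_product a b u0 \<phi> f w t) = cmod (f t) * cmod (\<phi> (t - w))"
  by (simp add: chirped_product_def norm_mult)

lemma integrable_chirped_product:
  assumes [measurable]: "f \<in> borel_measurable borel" "\<phi> \<in> borel_measurable borel"
    and f2: "integrable lborel (\<lambda>t. (cmod (f t))\<^sup>2)" and \<phi>2: "integrable lborel (\<lambda>t. (cmod (\<phi> t))\<^sup>2)"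
  shows "integrable lborel (chirped_product a b u0 \<phi> f w)"
  by (rule Bochner_Integration.integrable_bound[OF integrable_L2_mult_cnj[OF _ _ f2 integrable_lborel_shift[OF \<phi>2, of w]]])
     (auto simp: cmod_chirped_product norm_mult)

lemma wolct_eq_fourier:
  assumes [measurable]: "f \<in> borel_measurable borel" "\<phi> \<in> borel_measurable borel"
  shows "wolct (a, b, c, d, u0, w0) \<phi> f u w =
    1 / csqrt (\<i> * of_real (2 * pi * b)) * iexp (- 1 / b * u * (d * u0 - b * w0) + d / (2 * b) * (u\<^sup>2 + u0\<^sup>2)) *
    fourier (chirped_product a b u0 \<phi> f w) (u / b)"
proof -
  have "wolct (a, b, c, d, u0, w0) \<phi> f u w =
      (\<integral>t. f t * cnj (\<phi> (t - w)) * olct_kernel (a, b, c, d, u0, w0) t u \<partial>lborel)"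
    unfolding wolct_def by (rule integral_completion) simp
  also have "\<dots> = (\<integral>t. (1 / csqrt (\<i> * of_real (2 * pi * b)) *
      iexp (- 1 / b * u * (d * u0 - b * w0) + d / (2 * b) * (u\<^sup>2 + u0\<^sup>2))) *
      (chirped_product a b u0 \<phi> f w t * iexp (- (t * (u / b)))) \<partial>lborel)"
  proof (rule Bochner_Integration.integral_cong[OF refl])
    fix t :: real
    have phase: "a / (2 * b) * t\<^sup>2 - 1 / b * t * (u - u0) - 1 / b * u * (d * u0 - b * w0) + d / (2 * b) * (u\<^sup>2 + u0\<^sup>2) =
        (- 1 / b * u * (d * u0 - b * w0) + d / (2 * b) * (u\<^sup>2 + u0\<^sup>2)) +
        ((a / (2 * b) * t\<^sup>2 + t * u0 / b) + - (t * (u / b)))"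
      by (simp add: diff_divide_distrib right_diff_distrib)
    have iexp_add: "iexp (x + y) = iexp x * iexp y" for x y
      by (simp add: distrib_left exp_add)
    show "f t * cnj (\<phi> (t - w)) * olct_kernel (a, b, c, d, u0, w0) t u =
      (1 / csqrt (\<i> * of_real (2 * pi * b)) *
      iexp (- 1 / b * u * (d * u0 - b * w0) + d / (2 * b) * (u\<^sup>2 + u0\<^sup>2))) *
      (chirped_product a b u0 \<phi> f w t * iexp (- (t * (u / b))))"
      unfolding olct_kernel.simps phase iexp_add chirped_product_def by (simp only: mult_ac)
  qed
  also have "\<dots> = 1 / csqrt (\<i> * of_real (2 * pi * b)) * iexp (- 1 / b * u * (d * u0 - b * w0) + d / (2 * b) * (u\<^sup>2 + u0\<^sup>2)) *
    fourier (chirped_product a b u0 \<phi> f w) (u / b)"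
    unfolding fourier_def by (rule integral_mult_right_zero)
  finally show ?thesis .
qed

lemma wolct_measurable [measurable]:
  assumes [measurable]: "f \<in> borel_measurable borel" "\<phi> \<in> borel_measurable borel"
  shows "(\<lambda>(w, u). wolct (a, b, c, d, u0, w0) \<phi> f u w) \<in> borel_measurable (borel \<Otimes>\<^sub>M borel)"
  unfolding wolct_eq_fourier[OF assms] fourier_def by measurable

lemma cmod_wolct_square:
  assumes [measurable]: "f \<in> borel_measurable borel" "\<phi> \<in> borel_measurable borel"
  shows "(cmod (wolct (a, b, c, d, u0, w0) \<phi> f u w))\<^sup>2 =
    (cmod (fourier (chirped_product a b u0 \<phi> f w) (u / b)))\<^sup>2 / (2 * pi * \<bar>b\<bar>)"
proof -
  have "(cmod (csqrt (\<i> * of_real (2 * pi * b))))\<^sup>2 = cmod ((csqrt (\<i> * of_real (2 * pi * b)))\<^sup>2)"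
    by (rule norm_power[symmetric])
  also have "\<dots> = 2 * pi * \<bar>b\<bar>"
    unfolding power2_csqrt by (simp add: norm_mult abs_mult)
  finally show ?thesis
    unfolding wolct_eq_fourier[OF assms] by (simp only: norm_mult norm_divide power_mult_distrib power_divide norm_exp_i_times) simp
qed

text \<open>The scaling \<open>u = b x\<close> contributes \<open>\<bar>b\<bar>\<close>, the normalising factor of the kernel \<open>1 / (2 \<pi> \<bar>b\<bar>)\<close>
  and Plancherel's formula \<open>2 \<pi>\<close>; these cancel.\<close>

lemma nn_integral_wolct_slice:
  assumes [measurable]: "f \<in> borel_measurable borel" "\<phi> \<in> borel_measurable borel"
    and f2: "integrable lborel (\<lambda>t. (cmod (f t))\<^sup>2)" and \<phi>2: "integrable lborel (\<lambda>t. (cmod (\<phi> t))\<^sup>2)"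
    and slice: "integrable lborel (\<lambda>t. (cmod (f t) * cmod (\<phi> (t - w)))\<^sup>2)" and b: "b \<noteq> 0"
  shows "(\<integral>\<^sup>+u. ennreal ((cmod (wolct (a, b, c, d, u0, w0) \<phi> f u w))\<^sup>2) \<partial>lborel) =
    (\<integral>\<^sup>+t. ennreal ((cmod (f t) * cmod (\<phi> (t - w)))\<^sup>2) \<partial>lborel)"
proof -
  let ?g = "chirped_product a b u0 \<phi> f w"
  have pos: "2 * pi * \<bar>b\<bar> > 0" using b by simp
  have "(\<integral>\<^sup>+u. ennreal ((cmod (wolct (a, b, c, d, u0, w0) \<phi> f u w))\<^sup>2) \<partial>lborel) =
      ennreal \<bar>b\<bar> * (\<integral>\<^sup>+x. ennreal ((cmod (fourier ?g x))\<^sup>2 / (2 * pi * \<bar>b\<bar>)) \<partial>lborel)"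
    unfolding cmod_wolct_square[OF assms(1,2)]
    using b by (subst nn_integral_real_affine[where c = b and t = 0]) auto
  also have "\<dots> = (\<integral>\<^sup>+x. ennreal (1 / (2 * pi)) * ennreal ((cmod (fourier ?g x))\<^sup>2) \<partial>lborel)"
    using b by (subst nn_integral_cmult[symmetric])
      (auto intro!: nn_integral_cong simp: ennreal_mult[symmetric] field_simps)
  also have "\<dots> = ennreal (1 / (2 * pi)) * (ennreal (2 * pi) * (\<integral>\<^sup>+t. ennreal ((cmod (?g t))\<^sup>2) \<partial>lborel))"
    using integrable_chirped_product[OF assms(1,2) f2 \<phi>2, of a b u0 w] slice
    by (subst nn_integral_cmult, simp, subst plancherel) (simp_all add: cmod_chirped_product)
  also have "\<dots> = (\<integral>\<^sup>+t. ennreal ((cmod (?g t))\<^sup>2) \<partial>lborel)"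
    by (simp add: mult.assoc[symmetric] ennreal_mult[symmetric])
  finally show ?thesis
    by (simp add: cmod_chirped_product)
qed

lemma nn_integral_correlation:
  fixes f \<phi> :: "real \<Rightarrow> complex"
  assumes [measurable]: "f \<in> borel_measurable borel" "\<phi> \<in> borel_measurable borel"
  shows "(\<integral>\<^sup>+w. \<integral>\<^sup>+t. ennreal ((cmod (f t) * cmod (\<phi> (t - w)))\<^sup>2) \<partial>lborel \<partial>lborel) =
    (\<integral>\<^sup>+t. ennreal ((cmod (f t))\<^sup>2) \<partial>lborel) * (\<integral>\<^sup>+t. ennreal ((cmod (\<phi> t))\<^sup>2) \<partial>lborel)"
proof -
  have "(\<integral>\<^sup>+w. \<integral>\<^sup>+t. ennreal ((cmod (f t) * cmod (\<phi> (t - w)))\<^sup>2) \<partial>lborel \<partial>lborel) =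
      (\<integral>\<^sup>+t. \<integral>\<^sup>+w. ennreal ((cmod (f t) * cmod (\<phi> (t - w)))\<^sup>2) \<partial>lborel \<partial>lborel)"
    by (rule lborel_pair.Fubini') measurable
  also have "\<dots> = (\<integral>\<^sup>+t. ennreal ((cmod (f t))\<^sup>2) * (\<integral>\<^sup>+w. ennreal ((cmod (\<phi> w))\<^sup>2) \<partial>lborel) \<partial>lborel)"
  proof (rule nn_integral_cong)
    fix t :: real
    have "(\<integral>\<^sup>+w. ennreal ((cmod (f t) * cmod (\<phi> (t - w)))\<^sup>2) \<partial>lborel) =
        ennreal ((cmod (f t))\<^sup>2) * (\<integral>\<^sup>+w. ennreal ((cmod (\<phi> (t - w)))\<^sup>2) \<partial>lborel)"
      by (simp add: power_mult_distrib ennreal_mult nn_integral_cmult)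
    also have "(\<integral>\<^sup>+w. ennreal ((cmod (\<phi> (t - w)))\<^sup>2) \<partial>lborel) = (\<integral>\<^sup>+w. ennreal ((cmod (\<phi> w))\<^sup>2) \<partial>lborel)"
      by (subst (2) nn_integral_real_affine[where c = "-1" and t = t]) auto
    finally show "(\<integral>\<^sup>+w. ennreal ((cmod (f t) * cmod (\<phi> (t - w)))\<^sup>2) \<partial>lborel) =
        ennreal ((cmod (f t))\<^sup>2) * (\<integral>\<^sup>+w. ennreal ((cmod (\<phi> w))\<^sup>2) \<partial>lborel)" .
  qed
  also have "\<dots> = (\<integral>\<^sup>+t. ennreal ((cmod (f t))\<^sup>2) \<partial>lborel) * (\<integral>\<^sup>+t. ennreal ((cmod (\<phi> t))\<^sup>2) \<partial>lborel)"
    by (rule nn_integral_multc) simp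
  finally show ?thesis .
qed

text \<open>A slice at \<open>w\<close> need not be square integrable, but by \<open>nn_integral_correlation\<close> almost every slice is, and
  for those \<open>nn_integral_wolct_slice\<close> applies.\<close>

theorem wolct_moyal:
  assumes [measurable]: "f \<in> borel_measurable borel" "\<phi> \<in> borel_measurable borel"
    and f2: "integrable lborel (\<lambda>t. (cmod (f t))\<^sup>2)" and \<phi>2: "integrable lborel (\<lambda>t. (cmod (\<phi> t))\<^sup>2)"
    and b: "b \<noteq> 0"
  shows "(\<integral>\<^sup>+w. \<integral>\<^sup>+u. ennreal ((cmod (wolct (a, b, c, d, u0, w0) \<phi> f u w))\<^sup>2) \<partial>lborel \<partial>lborel) =
    (\<integral>\<^sup>+t. ennreal ((cmod (f t))\<^sup>2) \<partial>lborel) * (\<integral>\<^sup>+t. ennreal ((cmod (\<phi> t))\<^sup>2) \<partial>lborel)"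
proof -
  have "AE w in lborel. (\<integral>\<^sup>+t. ennreal ((cmod (f t) * cmod (\<phi> (t - w)))\<^sup>2) \<partial>lborel) \<noteq> \<infinity>"
  proof (rule nn_integral_PInf_AE)
    show "(\<integral>\<^sup>+w. \<integral>\<^sup>+t. ennreal ((cmod (f t) * cmod (\<phi> (t - w)))\<^sup>2) \<partial>lborel \<partial>lborel) \<noteq> \<infinity>"
      unfolding nn_integral_correlation[OF assms(1,2)]
      using f2 \<phi>2 by (simp add: nn_integral_eq_integral ennreal_mult_eq_top_iff)
  qed measurable
  then have "AE w in lborel. (\<integral>\<^sup>+u. ennreal ((cmod (wolct (a, b, c, d, u0, w0) \<phi> f u w))\<^sup>2) \<partial>lborel) =
      (\<integral>\<^sup>+t. ennreal ((cmod (f t) * cmod (\<phi> (t - w)))\<^sup>2) \<partial>lborel)"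
  proof eventually_elim
    case (elim w)
    have "integrable lborel (\<lambda>t. (cmod (f t) * cmod (\<phi> (t - w)))\<^sup>2)"
      using elim by (intro integrableI_nonneg) (auto simp: less_top)
    then show ?case
      by (rule nn_integral_wolct_slice[OF assms(1,2) f2 \<phi>2 _ b])
  qed
  then show ?thesis
    unfolding nn_integral_correlation[OF assms(1,2), symmetric] by (rule nn_integral_cong_AE)
qed

text \<open>The kernel has constant modulus, so the Cauchy-Schwarz inequality against the indicator of \<open>D\<close> gives a bound
  that is uniform in \<open>u\<close>; integrating it over \<open>u \<in> S\<close> produces the factor \<open>\<bar>S\<bar>\<close>. With the convention
  \<open>0 * \<infinity> = 0\<close> the estimate remains true when one of the sets is null and the other has infinite measure.\<close>

lemma wolct_local_bound:
  assumes [measurable]: "f \<in> borel_measurable borel" "\<phi> \<in> borel_measurable borel"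
    "D \<in> sets borel" "S \<in> sets borel"
    and f2: "integrable lborel (\<lambda>t. (cmod (f t))\<^sup>2)" and \<phi>2: "integrable lborel (\<lambda>t. (cmod (\<phi> t))\<^sup>2)"
    and b: "b \<noteq> 0" and supp: "\<And>t. t \<notin> D \<Longrightarrow> f t = 0"
  shows "(\<integral>\<^sup>+w. \<integral>\<^sup>+u. ennreal ((cmod (wolct (a, b, c, d, u0, w0) \<phi> f u w))\<^sup>2) * indicator S u \<partial>lborel \<partial>lborel) \<le>
    ennreal (1 / (2 * pi * \<bar>b\<bar>)) * (emeasure lborel D * emeasure lborel S) *
    ((\<integral>\<^sup>+t. ennreal ((cmod (f t))\<^sup>2) \<partial>lborel) * (\<integral>\<^sup>+t. ennreal ((cmod (\<phi> t))\<^sup>2) \<partial>lborel))"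
proof -
  let ?I = "\<lambda>w. \<integral>\<^sup>+t. ennreal ((cmod (f t) * cmod (\<phi> (t - w)))\<^sup>2) \<partial>lborel"
  let ?c = "ennreal (1 / (2 * pi * \<bar>b\<bar>))"
  have pointwise: "ennreal ((cmod (wolct (a, b, c, d, u0, w0) \<phi> f u w))\<^sup>2) \<le> ?c * emeasure lborel D * ?I w" for u w
  proof -
    let ?g = "chirped_product a b u0 \<phi> f w"
    have g: "integrable lborel ?g"
      by (rule integrable_chirped_product[OF assms(1,2) f2 \<phi>2])
    have "ennreal (cmod (fourier ?g (u / b))) \<le> (\<integral>\<^sup>+t. ennreal (cmod (?g t)) \<partial>lborel)"
      using cmod_fourier_le[OF g, of "u / b"] g
      by (subst nn_integral_eq_integral) (auto intro: ennreal_leI)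
    also have "\<dots> = (\<integral>\<^sup>+t. indicator D t * ennreal (cmod (f t) * cmod (\<phi> (t - w))) \<partial>lborel)"
      by (intro nn_integral_cong) (auto simp: cmod_chirped_product indicator_def supp)
    finally have "(ennreal (cmod (fourier ?g (u / b))))\<^sup>2 \<le>
        (\<integral>\<^sup>+t. indicator D t * ennreal (cmod (f t) * cmod (\<phi> (t - w))) \<partial>lborel)\<^sup>2"
      by (rule power_mono) simp
    also have "\<dots> \<le> (\<integral>\<^sup>+t. (indicator D t)\<^sup>2 \<partial>lborel) * (\<integral>\<^sup>+t. (ennreal (cmod (f t) * cmod (\<phi> (t - w))))\<^sup>2 \<partial>lborel)"
      by (rule Cauchy_Schwarz_nn_integral) measurable
    also have "(\<integral>\<^sup>+t. (indicator D t)\<^sup>2 \<partial>lborel) = (\<integral>\<^sup>+t. indicator D t \<partial>lborel)"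
      by (intro nn_integral_cong) (auto simp: indicator_def)
    also have "\<dots> = emeasure lborel D" by simp
    also have "(\<integral>\<^sup>+t. (ennreal (cmod (f t) * cmod (\<phi> (t - w))))\<^sup>2 \<partial>lborel) = ?I w"
      by (simp add: ennreal_power)
    finally have "ennreal ((cmod (fourier ?g (u / b)))\<^sup>2) \<le> emeasure lborel D * ?I w"
      by (simp add: ennreal_power)
    then have "?c * ennreal ((cmod (fourier ?g (u / b)))\<^sup>2) \<le> ?c * (emeasure lborel D * ?I w)"
      by (rule mult_left_mono) simp
    moreover have "?c * ennreal ((cmod (fourier ?g (u / b)))\<^sup>2) = ennreal ((cmod (wolct (a, b, c, d, u0, w0) \<phi> f u w))\<^sup>2)"
      unfolding cmod_wolct_square[OF assms(1,2)] by (simp add: ennreal_mult[symmetric])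
    ultimately show ?thesis by (simp add: mult.assoc)
  qed
  have "(\<integral>\<^sup>+w. \<integral>\<^sup>+u. ennreal ((cmod (wolct (a, b, c, d, u0, w0) \<phi> f u w))\<^sup>2) * indicator S u \<partial>lborel \<partial>lborel) \<le>
      (\<integral>\<^sup>+w. \<integral>\<^sup>+u. (?c * emeasure lborel D * ?I w) * indicator S u \<partial>lborel \<partial>lborel)"
    by (intro nn_integral_mono mult_right_mono pointwise) simp
  also have "\<dots> = (\<integral>\<^sup>+w. (?c * (emeasure lborel D * emeasure lborel S)) * ?I w \<partial>lborel)"
    by (intro nn_integral_cong, subst nn_integral_cmult_indicator) (auto simp: mult_ac)
  also have "\<dots> = (?c * (emeasure lborel D * emeasure lborel S)) * (\<integral>\<^sup>+w. ?I w \<partial>lborel)"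
    by (rule nn_integral_cmult) measurable
  finally show ?thesis
    unfolding nn_integral_correlation[OF assms(1,2)] .
qed

lemma wolct_add:
  assumes [measurable]: "f \<in> borel_measurable borel" "g \<in> borel_measurable borel" "\<phi> \<in> borel_measurable borel"
    and f2: "integrable lborel (\<lambda>t. (cmod (f t))\<^sup>2)" and g2: "integrable lborel (\<lambda>t. (cmod (g t))\<^sup>2)"
    and \<phi>2: "integrable lborel (\<lambda>t. (cmod (\<phi> t))\<^sup>2)"
  shows "wolct (a, b, c, d, u0, w0) \<phi> (\<lambda>t. f t + g t) u w =
    wolct (a, b, c, d, u0, w0) \<phi> f u w + wolct (a, b, c, d, u0, w0) \<phi> g u w"
proof -
  have fourier_int: "integrable lborel (\<lambda>t. chirped_product a b u0 \<phi> h w t * iexp (- (t * (u / b))))"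
    if "h \<in> borel_measurable borel" "integrable lborel (\<lambda>t. (cmod (h t))\<^sup>2)" for h
    using that
    by (intro Bochner_Integration.integrable_bound[OF integrable_chirped_product[OF that(1) assms(3) that(2) \<phi>2]])
       (auto simp: norm_mult)
  have "fourier (chirped_product a b u0 \<phi> (\<lambda>t. f t + g t) w) (u / b) =
      fourier (chirped_product a b u0 \<phi> f w) (u / b) + fourier (chirped_product a b u0 \<phi> g w) (u / b)"
    unfolding fourier_def
    using fourier_int[OF assms(1) f2] fourier_int[OF assms(2) g2]
    by (subst Bochner_Integration.integral_add[symmetric]) (auto simp: chirped_product_def algebra_simps)
  moreover have "(\<lambda>t. f t + g t) \<in> borel_measurable borel" by measurable
  ultimately show ?thesis
    by (simp only: wolct_eq_fourier[OF _ assms(3)] assms(1,2) distrib_left)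
qed

section \<open>The uncertainty inequality for Borel data\<close>

text \<open>Minkowski's inequality in \<open>L\<^sup>2\<close>, squared so that it can be combined with nonnegative integrals.\<close>

lemma nn_integral_minkowski_square:
  fixes G H :: "'a \<Rightarrow> real"
  assumes [measurable]: "G \<in> borel_measurable M" "H \<in> borel_measurable M"
    and nonneg: "\<And>x. G x \<ge> 0" "\<And>x. H x \<ge> 0" "X \<ge> 0" "Y \<ge> 0"
    and G: "(\<integral>\<^sup>+x. ennreal ((G x)\<^sup>2) \<partial>M) \<le> ennreal (X\<^sup>2)"
    and H: "(\<integral>\<^sup>+x. ennreal ((H x)\<^sup>2) \<partial>M) \<le> ennreal (Y\<^sup>2)"
  shows "(\<integral>\<^sup>+x. ennreal ((G x + H x)\<^sup>2) \<partial>M) \<le> ennreal ((X + Y)\<^sup>2)"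
proof -
  define I where "I = (\<integral>\<^sup>+x. ennreal (G x) * ennreal (H x) \<partial>M)"
  have "I\<^sup>2 \<le> (\<integral>\<^sup>+x. (ennreal (G x))\<^sup>2 \<partial>M) * (\<integral>\<^sup>+x. (ennreal (H x))\<^sup>2 \<partial>M)"
    unfolding I_def by (rule Cauchy_Schwarz_nn_integral) measurable
  also have "\<dots> \<le> ennreal (X\<^sup>2) * ennreal (Y\<^sup>2)"
    using G H nonneg by (intro mult_mono) (auto simp: ennreal_power)
  also have "\<dots> = ennreal ((X * Y)\<^sup>2)"
    by (simp add: ennreal_mult[symmetric] power_mult_distrib)
  finally have I2: "I\<^sup>2 \<le> ennreal ((X * Y)\<^sup>2)" .
  have I: "I \<le> ennreal (X * Y)"
  proof (cases I)
    case (real i)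
    then have "i\<^sup>2 \<le> (X * Y)\<^sup>2"
      using I2 by (simp add: ennreal_power)
    then have "i \<le> X * Y"
      by (rule power2_le_imp_le) (simp add: nonneg)
    then show ?thesis using real by (simp add: ennreal_leI)
  next
    case top
    then show ?thesis using I2 by (simp add: power2_eq_square top_unique)
  qed
  have "(\<integral>\<^sup>+x. ennreal ((G x + H x)\<^sup>2) \<partial>M) =
      (\<integral>\<^sup>+x. (ennreal ((G x)\<^sup>2) + 2 * (ennreal (G x) * ennreal (H x))) + ennreal ((H x)\<^sup>2) \<partial>M)"
  proof (rule nn_integral_cong)
    fix x
    have "ennreal ((G x + H x)\<^sup>2) = ennreal ((G x)\<^sup>2 + 2 * (G x * H x) + (H x)\<^sup>2)"
      by (simp add: power2_sum algebra_simps)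
    then show "ennreal ((G x + H x)\<^sup>2) = (ennreal ((G x)\<^sup>2) + 2 * (ennreal (G x) * ennreal (H x))) + ennreal ((H x)\<^sup>2)"
      by (simp add: ennreal_mult nonneg)
  qed
  also have "\<dots> = (\<integral>\<^sup>+x. ennreal ((G x)\<^sup>2) \<partial>M) + 2 * I + (\<integral>\<^sup>+x. ennreal ((H x)\<^sup>2) \<partial>M)"
    unfolding I_def by (simp add: nn_integral_add nn_integral_cmult)
  also have "\<dots> \<le> ennreal (X\<^sup>2) + 2 * ennreal (X * Y) + ennreal (Y\<^sup>2)"
    by (intro add_mono mult_left_mono G H I) simp
  also have "\<dots> = ennreal (X\<^sup>2 + 2 * (X * Y) + Y\<^sup>2)"
    by (simp add: ennreal_mult nonneg)
  also have "X\<^sup>2 + 2 * (X * Y) + Y\<^sup>2 = (X + Y)\<^sup>2"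
    by (simp add: power2_sum)
  finally show ?thesis .
qed

lemma uncertainty_borel:
  assumes fm [measurable]: "f \<in> borel_measurable borel" and \<phi>m [measurable]: "\<phi> \<in> borel_measurable borel"
    and [measurable]: "D \<in> sets borel" "S \<in> sets borel"
    and f2: "integrable lborel (\<lambda>t. (cmod (f t))\<^sup>2)" and \<phi>2: "integrable lborel (\<lambda>t. (cmod (\<phi> t))\<^sup>2)"
    and b: "b \<noteq> 0" and f0: "\<not> (AE t in lborel. f t = 0)" and \<phi>0: "\<not> (AE t in lborel. \<phi> t = 0)"
    and \<epsilon>: "\<epsilon>D \<ge> 0" "\<epsilon>S \<ge> 0" "\<epsilon>D + \<epsilon>S \<le> 1"
    and conc_D: "(\<integral>\<^sup>+t\<in>-D. ennreal ((cmod (f t))\<^sup>2) \<partial>lborel) \<le>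
      ennreal (\<epsilon>D\<^sup>2) * (\<integral>\<^sup>+t. ennreal ((cmod (f t))\<^sup>2) \<partial>lborel)"
    and conc_S: "(\<integral>\<^sup>+w. (\<integral>\<^sup>+u\<in>-S. ennreal ((cmod (wolct (a, b, c, d, u0, w0) \<phi> f u w))\<^sup>2) \<partial>lborel) \<partial>lborel) \<le>
      ennreal (\<epsilon>S\<^sup>2) * (\<integral>\<^sup>+w. \<integral>\<^sup>+u. ennreal ((cmod (wolct (a, b, c, d, u0, w0) \<phi> f u w))\<^sup>2) \<partial>lborel \<partial>lborel)"
  shows "ennreal (2 * pi * \<bar>b\<bar> * (1 - \<epsilon>D - \<epsilon>S)\<^sup>2) \<le> emeasure lborel D * emeasure lborel S"
proof (cases "emeasure lborel D * emeasure lborel S")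
  case top
  then show ?thesis by simp
next
  case (real r)
  let ?V = "wolct (a, b, c, d, u0, w0) \<phi>"
  have mass: "\<exists>m>0. (\<integral>\<^sup>+t. ennreal ((cmod (h t))\<^sup>2) \<partial>lborel) = ennreal m"
    if hm: "h \<in> borel_measurable borel" and h2: "integrable lborel (\<lambda>t. (cmod (h t))\<^sup>2)"
      and h0: "\<not> (AE t in lborel. h t = 0)" for h :: "real \<Rightarrow> complex"
  proof (intro exI conjI)
    show "(\<integral>\<^sup>+t. ennreal ((cmod (h t))\<^sup>2) \<partial>lborel) = ennreal (\<integral>t. (cmod (h t))\<^sup>2 \<partial>lborel)"
      using h2 by (rule nn_integral_eq_integral) simp
    have "(\<integral>t. (cmod (h t))\<^sup>2 \<partial>lborel) \<noteq> 0"
      using h0 by (subst integral_nonneg_eq_0_iff_AE[OF h2]) auto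
    moreover have "(\<integral>t. (cmod (h t))\<^sup>2 \<partial>lborel) \<ge> 0" by simp
    ultimately show "(\<integral>t. (cmod (h t))\<^sup>2 \<partial>lborel) > 0" by linarith
  qed
  obtain nf where nf: "nf > 0" "(\<integral>\<^sup>+t. ennreal ((cmod (f t))\<^sup>2) \<partial>lborel) = ennreal nf"
    using mass[OF fm f2 f0] by blast
  obtain np where np: "np > 0" "(\<integral>\<^sup>+t. ennreal ((cmod (\<phi> t))\<^sup>2) \<partial>lborel) = ennreal np"
    using mass[OF \<phi>m \<phi>2 \<phi>0] by blast
  define m where "m = nf * np"
  have m: "m > 0" unfolding m_def using nf(1) np(1) by simp
  define fD where "fD t = (if t \<in> D then f t else 0)" for t
  define fC where "fC t = (if t \<in> D then 0 else f t)" for t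
  have [measurable]: "fD \<in> borel_measurable borel" "fC \<in> borel_measurable borel"
    unfolding fD_def[abs_def] fC_def[abs_def] by measurable
  have fD2: "integrable lborel (\<lambda>t. (cmod (fD t))\<^sup>2)"
    by (rule Bochner_Integration.integrable_bound[OF f2]) (auto simp: fD_def)
  have fC2: "integrable lborel (\<lambda>t. (cmod (fC t))\<^sup>2)"
    by (rule Bochner_Integration.integrable_bound[OF f2]) (auto simp: fC_def)
  have split: "?V f u w = ?V fD u w + ?V fC u w" for u w
  proof -
    have "f = (\<lambda>t. fD t + fC t)" by (auto simp: fD_def fC_def)
    then show ?thesis
      using wolct_add[OF _ _ \<phi>m fD2 fC2 \<phi>2, of a b c d u0 w0 u w] by simp
  qed
  have Vm [measurable]: "(\<lambda>p. ?V h (snd p) (fst p)) \<in> borel_measurable (borel \<Otimes>\<^sub>M borel)"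
    if "h \<in> borel_measurable borel" for h
    using wolct_measurable[OF that \<phi>m, of a b c d u0 w0] by (simp add: case_prod_beta')
  have fst_snd: "(\<integral>\<^sup>+w. \<integral>\<^sup>+u. H (w, u) \<partial>lborel \<partial>lborel) = (\<integral>\<^sup>+p. H p \<partial>(lborel \<Otimes>\<^sub>M lborel))"
    if "H \<in> borel_measurable (borel \<Otimes>\<^sub>M borel)" for H :: "real \<times> real \<Rightarrow> ennreal"
    using that by (intro lborel.nn_integral_fst) simp

  define P where "P = (\<integral>\<^sup>+w. \<integral>\<^sup>+u. ennreal ((cmod (?V f u w))\<^sup>2) * indicator S u \<partial>lborel \<partial>lborel)"
  define Q where "Q = (\<integral>\<^sup>+w. \<integral>\<^sup>+u. ennreal ((cmod (?V f u w))\<^sup>2) * indicator (-S) u \<partial>lborel \<partial>lborel)"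
  have total: "(\<integral>\<^sup>+w. \<integral>\<^sup>+u. ennreal ((cmod (?V f u w))\<^sup>2) \<partial>lborel \<partial>lborel) = ennreal m"
    unfolding wolct_moyal[OF fm \<phi>m f2 \<phi>2 b] nf np m_def
    using nf np by (simp add: ennreal_mult)
  have "P + Q = (\<integral>\<^sup>+p. ennreal ((cmod (?V f (snd p) (fst p)))\<^sup>2) * indicator S (snd p) \<partial>(lborel \<Otimes>\<^sub>M lborel))
      + (\<integral>\<^sup>+p. ennreal ((cmod (?V f (snd p) (fst p)))\<^sup>2) * indicator (-S) (snd p) \<partial>(lborel \<Otimes>\<^sub>M lborel))"
    unfolding P_def Q_def by (subst (1 2) fst_snd[symmetric]) simp_all
  also have "\<dots> = (\<integral>\<^sup>+p. ennreal ((cmod (?V f (snd p) (fst p)))\<^sup>2) * indicator S (snd p)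
      + ennreal ((cmod (?V f (snd p) (fst p)))\<^sup>2) * indicator (-S) (snd p) \<partial>(lborel \<Otimes>\<^sub>M lborel))"
    by (rule nn_integral_add[symmetric]) simp_all
  also have "\<dots> = (\<integral>\<^sup>+p. ennreal ((cmod (?V f (snd p) (fst p)))\<^sup>2) \<partial>(lborel \<Otimes>\<^sub>M lborel))"
    by (rule nn_integral_cong) (simp add: indicator_def)
  also have "\<dots> = ennreal m"
    unfolding total[symmetric] by (subst fst_snd[symmetric]) simp_all
  finally have PQ: "P + Q = ennreal m" .
  have Q: "Q \<le> ennreal (\<epsilon>S\<^sup>2 * m)"
    using conc_S unfolding Q_def total by (simp add: ennreal_mult m less_imp_le)

  define s where "s = sqrt (r / (2 * pi * \<bar>b\<bar>))"
  have s: "s \<ge> 0" "s\<^sup>2 = r / (2 * pi * \<bar>b\<bar>)"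
    unfolding s_def using real by simp_all
  have "(\<integral>\<^sup>+w. \<integral>\<^sup>+u. ennreal ((cmod (?V fD u w))\<^sup>2) * indicator S u \<partial>lborel \<partial>lborel) \<le>
      ennreal (1 / (2 * pi * \<bar>b\<bar>)) * (emeasure lborel D * emeasure lborel S) *
      ((\<integral>\<^sup>+t. ennreal ((cmod (fD t))\<^sup>2) \<partial>lborel) * (\<integral>\<^sup>+t. ennreal ((cmod (\<phi> t))\<^sup>2) \<partial>lborel))"
    by (rule wolct_local_bound[OF _ _ _ _ fD2 \<phi>2 b]) (simp_all add: fD_def)
  also have "\<dots> \<le> ennreal (1 / (2 * pi * \<bar>b\<bar>)) * ennreal r * (ennreal nf * ennreal np)"
    unfolding real np(2) nf(2)[symmetric]
    by (intro mult_left_mono mult_right_mono nn_integral_mono) (simp_all add: fD_def)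
  also have "\<dots> = ennreal ((s * sqrt m)\<^sup>2)"
    using real nf np m by (simp add: s power_mult_distrib ennreal_mult[symmetric] m_def)
  finally have boundD: "(\<integral>\<^sup>+w. \<integral>\<^sup>+u. ennreal ((cmod (?V fD u w))\<^sup>2) * indicator S u \<partial>lborel \<partial>lborel) \<le>
      ennreal ((s * sqrt m)\<^sup>2)" .

  have "(\<integral>\<^sup>+w. \<integral>\<^sup>+u. ennreal ((cmod (?V fC u w))\<^sup>2) * indicator S u \<partial>lborel \<partial>lborel) \<le>
      (\<integral>\<^sup>+w. \<integral>\<^sup>+u. ennreal ((cmod (?V fC u w))\<^sup>2) \<partial>lborel \<partial>lborel)"
    by (intro nn_integral_mono) (simp add: indicator_def)
  also have "\<dots> = (\<integral>\<^sup>+t. ennreal ((cmod (fC t))\<^sup>2) \<partial>lborel) * (\<integral>\<^sup>+t. ennreal ((cmod (\<phi> t))\<^sup>2) \<partial>lborel)"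
    by (rule wolct_moyal[OF _ _ fC2 \<phi>2 b]) simp_all
  also have "(\<integral>\<^sup>+t. ennreal ((cmod (fC t))\<^sup>2) \<partial>lborel) = (\<integral>\<^sup>+t\<in>-D. ennreal ((cmod (f t))\<^sup>2) \<partial>lborel)"
    by (rule nn_integral_cong) (simp add: fC_def indicator_def)
  also have "\<dots> * (\<integral>\<^sup>+t. ennreal ((cmod (\<phi> t))\<^sup>2) \<partial>lborel) \<le> (ennreal (\<epsilon>D\<^sup>2) * ennreal nf) * ennreal np"
    unfolding np(2) nf(2)[symmetric] by (intro mult_right_mono conc_D) simp
  also have "\<dots> = ennreal ((\<epsilon>D * sqrt m)\<^sup>2)"
    using nf np m by (simp add: power_mult_distrib ennreal_mult[symmetric] m_def mult.assoc)
  finally have boundC: "(\<integral>\<^sup>+w. \<integral>\<^sup>+u. ennreal ((cmod (?V fC u w))\<^sup>2) * indicator S u \<partial>lborel \<partial>lborel) \<le>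
      ennreal ((\<epsilon>D * sqrt m)\<^sup>2)" .

  define G where "G h p = cmod (?V h (snd p) (fst p)) * indicat_real S (snd p)" for h p
  have Gm [measurable]: "G h \<in> borel_measurable (lborel \<Otimes>\<^sub>M lborel)" if [measurable]: "h \<in> borel_measurable borel" for h
    unfolding G_def[abs_def] by simp
  have G_eq: "(\<integral>\<^sup>+p. ennreal ((G h p)\<^sup>2) \<partial>(lborel \<Otimes>\<^sub>M lborel)) =
      (\<integral>\<^sup>+w. \<integral>\<^sup>+u. ennreal ((cmod (?V h u w))\<^sup>2) * indicator S u \<partial>lborel \<partial>lborel)"
    if [measurable]: "h \<in> borel_measurable borel" for h
  proof -
    have "(\<integral>\<^sup>+p. ennreal ((G h p)\<^sup>2) \<partial>(lborel \<Otimes>\<^sub>M lborel)) =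
        (\<integral>\<^sup>+p. ennreal ((cmod (?V h (snd p) (fst p)))\<^sup>2) * indicator S (snd p) \<partial>(lborel \<Otimes>\<^sub>M lborel))"
      by (rule nn_integral_cong) (simp add: G_def indicator_def)
    then show ?thesis
      by (subst (asm) (2) fst_snd[symmetric]) simp_all
  qed
  have "P = (\<integral>\<^sup>+p. ennreal ((G f p)\<^sup>2) \<partial>(lborel \<Otimes>\<^sub>M lborel))"
    unfolding P_def by (rule G_eq[symmetric]) simp
  also have "\<dots> \<le> (\<integral>\<^sup>+p. ennreal ((G fD p + G fC p)\<^sup>2) \<partial>(lborel \<Otimes>\<^sub>M lborel))"
  proof (intro nn_integral_mono ennreal_leI power_mono)
    show "G f p \<le> G fD p + G fC p" for p
      unfolding G_def split distrib_right[symmetric]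
      by (intro mult_right_mono norm_triangle_ineq) simp
    show "0 \<le> G f p" for p by (simp add: G_def)
  qed
  also have "\<dots> \<le> ennreal ((s * sqrt m + \<epsilon>D * sqrt m)\<^sup>2)"
  proof (rule nn_integral_minkowski_square)
    show "0 \<le> G fD p" "0 \<le> G fC p" for p by (simp_all add: G_def)
    show "(\<integral>\<^sup>+p. ennreal ((G fD p)\<^sup>2) \<partial>(lborel \<Otimes>\<^sub>M lborel)) \<le> ennreal ((s * sqrt m)\<^sup>2)"
      using boundD by (subst G_eq) simp_all
    show "(\<integral>\<^sup>+p. ennreal ((G fC p)\<^sup>2) \<partial>(lborel \<Otimes>\<^sub>M lborel)) \<le> ennreal ((\<epsilon>D * sqrt m)\<^sup>2)"
      using boundC by (subst G_eq) simp_all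
    show "0 \<le> s * sqrt m" "0 \<le> \<epsilon>D * sqrt m" using s(1) \<epsilon>(1) m by simp_all
  qed simp_all
  also have "(s * sqrt m + \<epsilon>D * sqrt m)\<^sup>2 = (s + \<epsilon>D)\<^sup>2 * m"
    using m by (simp add: distrib_right[symmetric] power_mult_distrib)
  finally have P: "P \<le> ennreal ((s + \<epsilon>D)\<^sup>2 * m)" .

  have "ennreal m \<le> ennreal ((s + \<epsilon>D)\<^sup>2 * m) + ennreal (\<epsilon>S\<^sup>2 * m)"
    unfolding PQ[symmetric] by (intro add_mono P Q)
  also have "\<dots> = ennreal (((s + \<epsilon>D)\<^sup>2 + \<epsilon>S\<^sup>2) * m)"
    using m by (simp add: distrib_right)
  finally have "1 * m \<le> ((s + \<epsilon>D)\<^sup>2 + \<epsilon>S\<^sup>2) * m"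
    using m by simp
  then have main: "1 \<le> (s + \<epsilon>D)\<^sup>2 + \<epsilon>S\<^sup>2"
    using m by (simp only: mult_le_cancel_right_pos)
  \<comment> \<open>Over the strip \<open>u \<in> S\<close> there remains the share \<open>1 - \<epsilon>S\<^sup>2\<close>, which is at least \<open>(1 - \<epsilon>S)\<^sup>2\<close> as \<open>\<epsilon>S \<le> 1\<close>.\<close>
  have "\<epsilon>S * \<epsilon>S \<le> \<epsilon>S * 1" using \<epsilon> by (intro mult_left_mono) auto
  then have "(1 - \<epsilon>S)\<^sup>2 \<le> (s + \<epsilon>D)\<^sup>2"
    using main by (simp add: power2_eq_square algebra_simps)
  then have "1 - \<epsilon>S \<le> s + \<epsilon>D"
    using s(1) \<epsilon>(1) by (intro power2_le_imp_le[of "1 - \<epsilon>S"]) simp_all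
  then have "(1 - \<epsilon>D - \<epsilon>S)\<^sup>2 \<le> s\<^sup>2"
    using \<epsilon> by (intro power_mono) auto
  then have "2 * pi * \<bar>b\<bar> * (1 - \<epsilon>D - \<epsilon>S)\<^sup>2 \<le> r"
    unfolding s(2) using b by (simp add: field_simps)
  then show ?thesis
    unfolding real by (rule ennreal_leI)
qed

section \<open>From Lebesgue measurable to Borel data\<close>

lemma borel_representative:
  fixes f :: "real \<Rightarrow> complex"
  assumes [measurable]: "f \<in> borel_measurable lebesgue"
  obtains g where "g \<in> borel_measurable borel" "AE t in lborel. f t = g t"
proof -
  have "(\<lambda>t. Re (f t)) \<in> borel_measurable lebesgue" "(\<lambda>t. Im (f t)) \<in> borel_measurable lebesgue"
    by measurable
  then obtain p q where [measurable]: "p \<in> borel_measurable lborel" "q \<in> borel_measurable lborel"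
    and pq: "AE t in lborel. Re (f t) = p t" "AE t in lborel. Im (f t) = q t"
    using completion_ex_borel_measurable_real by metis
  show thesis
  proof (rule that)
    show "(\<lambda>t. Complex (p t) (q t)) \<in> borel_measurable borel"
      unfolding Complex_eq by simp
    show "AE t in lborel. f t = Complex (p t) (q t)"
      using pq by eventually_elim (simp add: complex_eq_iff)
  qed
qed

lemma borel_representative_set:
  fixes A :: "real set"
  assumes A: "A \<in> sets lebesgue"
  obtains B where "B \<in> sets borel" "AE t in lborel. t \<in> A \<longleftrightarrow> t \<in> B" "emeasure lebesgue A = emeasure lborel B"
proof -
  have "indicat_real A \<in> borel_measurable lebesgue" using A by simp
  then obtain p where [measurable]: "p \<in> borel_measurable lborel" and p: "AE t in lborel. indicat_real A t = p t"
    using completion_ex_borel_measurable_real by metis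
  define B where "B = {t \<in> space lborel. p t = 1}"
  have B: "B \<in> sets lborel" unfolding B_def by measurable
  have AB: "AE t in lborel. t \<in> A \<longleftrightarrow> t \<in> B"
    using p by eventually_elim (auto simp: B_def indicator_def split: if_splits)
  have "emeasure lebesgue A = emeasure lebesgue B"
    using A B AB by (intro emeasure_eq_AE) (auto simp: AE_completion_iff)
  with B AB show thesis by (intro that) simp_all
qed

text \<open>The exceptional set is enlarged to a Borel null set first, since \<open>P\<close> itself may fail to be measurable.\<close>

lemma AE_lborel_shift:
  assumes "AE t in lborel. P (t::real)"
  shows "AE t in lborel. P (t - w)"
proof -
  obtain N where N: "\<And>t. t \<in> space lborel - N \<Longrightarrow> P t" "N \<in> null_sets lborel"
    using AE_E3[OF assms] by blast
  have "AE t in lborel. t \<notin> N" by (rule AE_not_in[OF N(2)])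
  moreover have "Measurable.pred borel (\<lambda>t. t \<notin> N)"
    using N(2) by (intro pred_intros_logic) (auto dest: null_setsD2)
  ultimately have "AE t in lborel. (- w) + 1 * t \<notin> N"
    by (intro AE_borel_affine[of 1 "\<lambda>t. t \<notin> N"]) auto
  then show ?thesis
    by eventually_elim (use N(1) in auto)
qed

text \<open>The left-hand integrand inherits Lebesgue measurability from the Borel one, because Lebesgue measure is
  complete.\<close>

lemma wolct_cong_AE:
  assumes f: "AE t in lborel. f t = f' t" and \<phi>: "AE t in lborel. \<phi> t = \<phi>' t"
    and [measurable]: "f' \<in> borel_measurable borel" "\<phi>' \<in> borel_measurable borel"
  shows "wolct A \<phi> f u w = wolct A \<phi>' f' u w"
proof -
  obtain a b c d u0 w0 where A: "A = (a, b, c, d, u0, w0)" by (metis surj_pair)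
  have ae: "AE t in lebesgue. f' t * cnj (\<phi>' (t - w)) * olct_kernel A t u = f t * cnj (\<phi> (t - w)) * olct_kernel A t u"
    unfolding AE_completion_iff using f AE_lborel_shift[OF \<phi>, of w] by eventually_elim simp
  have "(\<lambda>t. f' t * cnj (\<phi>' (t - w)) * olct_kernel A t u) \<in> borel_measurable lborel"
    unfolding A olct_kernel.simps by measurable
  then have m: "(\<lambda>t. f' t * cnj (\<phi>' (t - w)) * olct_kernel A t u) \<in> borel_measurable lebesgue"
    by (rule measurable_completion)
  show ?thesis
    unfolding wolct_def
    by (rule integral_cong_AE[OF borel_measurable_AE[OF m ae] m AE_symmetric[OF ae]])
qed

lemma L2_borel_representative:
  assumes "f \<in> L2"
  obtains g where "g \<in> borel_measurable borel" "AE t in lborel. f t = g t"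
    "integrable lborel (\<lambda>t. (cmod (g t))\<^sup>2)"
proof -
  have f: "f \<in> borel_measurable lebesgue" "integrable lebesgue (\<lambda>t. (cmod (f t))\<^sup>2)"
    using assms by (auto simp: L2_def)
  obtain g where [measurable]: "g \<in> borel_measurable borel" and fg: "AE t in lborel. f t = g t"
    using borel_representative[OF f(1)] by blast
  have "(\<lambda>t. (cmod (g t))\<^sup>2) \<in> borel_measurable lebesgue"
    by (rule measurable_completion) simp
  moreover have "AE t in lebesgue. (cmod (f t))\<^sup>2 = (cmod (g t))\<^sup>2"
    unfolding AE_completion_iff using fg by eventually_elim simp
  ultimately have "integrable lebesgue (\<lambda>t. (cmod (g t))\<^sup>2)"
    using integrable_cong_AE_imp[OF f(2)] by (metis (no_types, lifting) AE_cong eq_commute)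
  then have "integrable lborel (\<lambda>t. (cmod (g t))\<^sup>2)"
    by (subst (asm) integrable_completion) simp_all
  with fg show thesis by (intro that) simp_all
qed

lemma ennsqrt_le_D:
  assumes "ennsqrt x \<le> ennreal \<epsilon> * ennsqrt y" and "\<epsilon> \<ge> 0" and "y \<noteq> \<infinity>"
  shows "x \<le> ennreal (\<epsilon>\<^sup>2) * y"
proof -
  obtain v where v: "y = ennreal v" "v \<ge> 0" using assms(3) by (cases y) auto
  have y: "ennreal \<epsilon> * ennsqrt y = ennreal (\<epsilon> * sqrt v)"
    using v assms(2) by (simp add: ennsqrt_def ennreal_mult)
  have "x \<noteq> \<infinity>"
    using assms(1) unfolding y by (auto simp: ennsqrt_def top_unique)
  then obtain z where z: "x = ennreal z" "z \<ge> 0" by (cases x) auto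
  have "sqrt z \<le> \<epsilon> * sqrt v"
    using assms(1) z v assms(2) unfolding y by (simp add: ennsqrt_def)
  then have "(sqrt z)\<^sup>2 \<le> (\<epsilon> * sqrt v)\<^sup>2"
    using z by (intro power_mono) auto
  then have "z \<le> \<epsilon>\<^sup>2 * v"
    using z v by (simp add: power_mult_distrib)
  then show ?thesis
    using z v assms(2) by (simp add: ennreal_mult[symmetric] ennreal_leI)
qed

theorem theorem5:
  fixes a b c d u0 w0 :: real
    and \<phi> f :: "real \<Rightarrow> complex"
    and \<epsilon>D \<epsilon>S :: real
    and D S :: "real set"
  assumes "a * d - b * c = 1" and "b \<noteq> 0"
    and "\<phi> \<in> L2" and "\<not> (AE t in lebesgue. \<phi> t = 0)"
    and "f \<in> L2" and "\<not> (AE t in lebesgue. f t = 0)"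
    and "\<epsilon>D \<ge> 0" and "\<epsilon>S \<ge> 0" and "\<epsilon>D + \<epsilon>S \<le> 1"
    and "D \<in> sets lebesgue" and "S \<in> sets lebesgue"
    and "concentrated \<epsilon>D f D"
    and "tf_concentrated \<epsilon>S (wolct (a, b, c, d, u0, w0) \<phi> f) S"
  shows "emeasure lebesgue D * emeasure lebesgue S \<ge> ennreal (2 * pi * b * (1 - \<epsilon>D - \<epsilon>S)\<^sup>2)"
proof -
  obtain g where g [measurable]: "g \<in> borel_measurable borel" and fg: "AE t in lborel. f t = g t"
    and g2: "integrable lborel (\<lambda>t. (cmod (g t))\<^sup>2)"
    using L2_borel_representative[OF assms(5)] by blast
  obtain \<psi> where \<psi> [measurable]: "\<psi> \<in> borel_measurable borel" and \<phi>\<psi>: "AE t in lborel. \<phi> t = \<psi> t"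
    and \<psi>2: "integrable lborel (\<lambda>t. (cmod (\<psi> t))\<^sup>2)"
    using L2_borel_representative[OF assms(3)] by blast
  obtain D' where D' [measurable]: "D' \<in> sets borel" and DD': "AE t in lborel. t \<in> D \<longleftrightarrow> t \<in> D'"
    and D: "emeasure lebesgue D = emeasure lborel D'"
    using borel_representative_set[OF assms(10)] by blast
  obtain S' where S' [measurable]: "S' \<in> sets borel" and SS': "AE t in lborel. t \<in> S \<longleftrightarrow> t \<in> S'"
    and S: "emeasure lebesgue S = emeasure lborel S'"
    using borel_representative_set[OF assms(11)] by blast
  let ?V = "wolct (a, b, c, d, u0, w0)"
  have V: "?V \<phi> f = ?V \<psi> g"
    using wolct_cong_AE[OF fg \<phi>\<psi> g \<psi>] by (intro ext)
  have g0: "\<not> (AE t in lborel. g t = 0)"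
  proof
    assume "AE t in lborel. g t = 0"
    with fg have "AE t in lborel. f t = 0" by eventually_elim simp
    with assms(6) show False by (simp add: AE_completion_iff)
  qed
  have \<psi>0: "\<not> (AE t in lborel. \<psi> t = 0)"
  proof
    assume "AE t in lborel. \<psi> t = 0"
    with \<phi>\<psi> have "AE t in lborel. \<phi> t = 0" by eventually_elim simp
    with assms(4) show False by (simp add: AE_completion_iff)
  qed
  have norm_f: "(\<integral>\<^sup>+t. ennreal ((cmod (f t))\<^sup>2) \<partial>lborel) = (\<integral>\<^sup>+t. ennreal ((cmod (g t))\<^sup>2) \<partial>lborel)"
    by (rule nn_integral_cong_AE) (use fg in eventually_elim, simp)
  have out_D: "(\<integral>\<^sup>+t\<in>-D. ennreal ((cmod (f t))\<^sup>2) \<partial>lborel) = (\<integral>\<^sup>+t\<in>-D'. ennreal ((cmod (g t))\<^sup>2) \<partial>lborel)"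
    by (rule nn_integral_cong_AE) (use fg DD' in eventually_elim, simp add: indicator_def)
  have out_S: "(\<integral>\<^sup>+u\<in>-S. ennreal ((cmod (?V \<psi> g u w))\<^sup>2) \<partial>lborel) =
      (\<integral>\<^sup>+u\<in>-S'. ennreal ((cmod (?V \<psi> g u w))\<^sup>2) \<partial>lborel)" for w
    by (rule nn_integral_cong_AE) (use SS' in eventually_elim, simp add: indicator_def)
  have fin_g: "(\<integral>\<^sup>+t. ennreal ((cmod (g t))\<^sup>2) \<partial>lborel) \<noteq> \<infinity>"
    and fin_\<psi>: "(\<integral>\<^sup>+t. ennreal ((cmod (\<psi> t))\<^sup>2) \<partial>lborel) \<noteq> \<infinity>"
    using g2 \<psi>2 by (simp_all add: nn_integral_eq_integral)
  have conc_D: "(\<integral>\<^sup>+t\<in>-D'. ennreal ((cmod (g t))\<^sup>2) \<partial>lborel) \<le>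
      ennreal (\<epsilon>D\<^sup>2) * (\<integral>\<^sup>+t. ennreal ((cmod (g t))\<^sup>2) \<partial>lborel)"
    using assms(12) unfolding concentrated_def nn_integral_completion norm_f out_D
    by (rule ennsqrt_le_D[OF _ assms(7) fin_g])
  have "(\<integral>\<^sup>+w. \<integral>\<^sup>+u. ennreal ((cmod (?V \<psi> g u w))\<^sup>2) \<partial>lborel \<partial>lborel) \<noteq> \<infinity>"
    unfolding wolct_moyal[OF g \<psi> g2 \<psi>2 assms(2)]
    using fin_g fin_\<psi> by (simp add: ennreal_mult_eq_top_iff)
  then have conc_S: "(\<integral>\<^sup>+w. (\<integral>\<^sup>+u\<in>-S'. ennreal ((cmod (?V \<psi> g u w))\<^sup>2) \<partial>lborel) \<partial>lborel) \<le>
      ennreal (\<epsilon>S\<^sup>2) * (\<integral>\<^sup>+w. \<integral>\<^sup>+u. ennreal ((cmod (?V \<psi> g u w))\<^sup>2) \<partial>lborel \<partial>lborel)"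
    using assms(13) unfolding tf_concentrated_def nn_integral_completion V out_S
    by (intro ennsqrt_le_D[OF _ assms(8)])
  have "ennreal (2 * pi * b * (1 - \<epsilon>D - \<epsilon>S)\<^sup>2) \<le> ennreal (2 * pi * \<bar>b\<bar> * (1 - \<epsilon>D - \<epsilon>S)\<^sup>2)"
    by (intro ennreal_leI mult_right_mono mult_left_mono) auto
  also have "\<dots> \<le> emeasure lborel D' * emeasure lborel S'"
    by (rule uncertainty_borel[OF g \<psi> D' S' g2 \<psi>2 assms(2) g0 \<psi>0 assms(7-9) conc_D conc_S])
  finally show ?thesis
    unfolding D S .
qed

end
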